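(* Let $\mathcal{D}=(G,\chi,a,\alpha)$ and $\mathcal{D}'=(G',\chi',a',\alpha')$ be two data and let $(H_{\mathcal{D}},\cdot,\mathbin{:})$ and $(H_{\mathcal{D}'},\cdot,\mathbin{:})$ be Hopf $q$-braces such that $x\cdot x=x\mathbin{:}x=0$ in both. Let $\lambda,\xi\colon G\to\mathds{k}^{\times}$ be the characters such that $x\cdot g=\lambda(g)x$ and $x\mathbin{:}g=\xi(g)x$ in $H_{\mathcal{D}}$ for all $g\in G$, and let $\lambda',\xi'\colon G'\to\mathds{k}^{\times}$ be the characters such that $x\cdot g=\lambda'(g)x$ and $x\mathbin{:}g=\xi'(g)x$ in $H_{\mathcal{D}'}$ for all $g\in G'$. Let $F\colon H_{\mathcal{D}}\to H_{\mathcal{D}'}$ be an isomorphism of Hopf algebras and let $f\colon G\to G'$ be the group isomorphism obtained by restricting $F$ to $G$. Then $F$ is an isomorphism of Hopf $q$-braces if and only if $f\colon(G,\cdot,\mathbin{:})\to(G',\cdot,\mathbin{:})$ is an isomorphism of $q$-braces, $\lambda=\lambda'\circ f$ and $\xi=\xi'\circ f$.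
   Context: $\mathds{k}$ is an algebraically closed field of characteristic zero, $\mathbb{N}_0=\{0,1,2,\dots\}$. Sweedler notation is used. Multiplication has precedence over the binary operations $\cdot$ and $\mathbin{:}$, which have precedence over $+$ and $-$. Rank one pointed Hopf algebras. A datum $\mathcal{D}=(G,\chi,a,\alpha)$ consists of a finite group $G$, a character $\chi\colon G\to\mathds{k}^{\times}$, a central element $a\in G$ and $\alpha\in\mathds{k}$ such that, denoting by $n$ the order of $\chi(a)$, one has $n>1$ and ($\alpha(a^n-1)=0$ in $\mathds{k}[G]$ or $\chi^n=1$). $H_{\mathcal{D}}$ is the Hopf algebra generated as an algebra by $G$ and $x$, subject to the group relations of $G$, $x^n=\alpha(a^n-1)$ and $xg=\chi(g)gx$ for $g\in G$, with $\Delta(x)=x\otimes a+1\otimes x$, $\Delta(g)=g\otimes g$ (so $\epsilon(g)=1$, $\epsilon(x)=0$). It has $\mathds{k}$-basis $\{gx^m: g\in G,\ 0\le m<n\}$; $G$ is its set of group-likes. Isomorphisms of $H_{\mathcal{D}}$ (known, Krop–Radford): each Hopf algebra isomorphism $F\colon H_{\mathcal{D}}\to H_{\mathcal{D}'}$ is given by $F(gx^m)=\alpha_0^mf(g)x^m$, where $f\colon G\to G'$ is a group isomorphism with $f(a)=a'$, $\chi=\chi'\circ f$, and $\alpha_0\in\mathds{k}^{\times}$ satisfies $\alpha_0^n\alpha'(a'^n-1)=\alpha(a'^n-1)$, where $n$ is the order of $\chi(a)$. Hopf $q$-braces. Let $X$ be a coalgebra and $p,d\colon X\otimes X\to X$ linear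 maps with $\epsilon\circ p=\epsilon\circ d=\epsilon\otimes\epsilon$; write $x\cdot y=p(x\otimes y)$, $x\mathbin{:}y=d(x\otimes y)$. $(X,\cdot,\mathbin{:})$ is a $q$-magma coalgebra if the map $X\otimes X^{\mathrm{cop}}\to X^{\mathrm{cop}}\otimes X$, $x\otimes y\mapsto y_{(1)}\mathbin{:}x_{(2)}\otimes x_{(1)}\cdot y_{(2)}$, is a coalgebra morphism. It is left regular if $x\otimes y\mapsto x\cdot y_{(1)}\otimes y_{(2)}$ is bijective on $X\otimes X$, right regular if $x\otimes y\mapsto x\mathbin{:}y_{(2)}\otimes y_{(1)}$ is bijective, and regular if it is both. A $q$-cycle coalgebra is a left regular $q$-magma coalgebra such that for all $u,v,w$: $(u\cdot v_{(1)})\cdot(w\mathbin{:}v_{(2)})=(u\cdot w_{(2)})\cdot(v\cdot w_{(1)})$, $(u\cdot v_{(1)})\mathbin{:}(w\cdot v_{(2)})=(u\mathbin{:}w_{(2)})\cdot(v\mathbin{:}w_{(1)})$, $(u\mathbin{:}v_{(1)})\mathbin{:}(w\mathbin{:}v_{(2)})=(u\mathbin{:}w_{(2)})\mathbin{:}(v\cdot w_{(1)})$. A Hopf $q$-brace is a Hopf algebra $H$ with a regular $q$-cycle coalgebra structure $(H,\cdot,\mathbin{:})$ such that $(H,\cdot)$ and $(H,\mathbin{:})$ are right $H^{\mathrm{op}}$-modules (i.e. $h\cdot 1=h$, $h\cdot kl=(h\cdot l)\cdot k$, and likewise for $\mathbin{:}$) and, for all $h,k,l\in H$, $hk\cdot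 l=(h\cdot(l_{(1)}\mathbin{:}k_{(2)}))(k_{(1)}\cdot l_{(2)})$ and $hk\mathbin{:}l=(h\mathbin{:}(l_{(1)}\cdot k_{(2)}))(k_{(1)}\mathbin{:}l_{(2)})$. A morphism of Hopf $q$-braces is a Hopf algebra morphism $f$ with $f(h\cdot h')=f(h)\cdot f(h')$ and $f(h\mathbin{:}h')=f(h)\mathbin{:}f(h')$. A $q$-brace structure on a group $G$ is a pair of binary operations $\cdot,\mathbin{:}$ on the set $G$ whose linear extensions make $\mathds{k}[G]$ a Hopf $q$-brace; morphisms are group morphisms preserving both operations. A Hopf $q$-brace on $H_{\mathcal{D}}$ restricts to a $q$-brace on $G$. Known facts: for a Hopf $q$-brace on $H_{\mathcal{D}}$ with $x\cdot x=x\mathbin{:}x=0$, there are characters $\lambda,\xi$ of $G$ such that for all $h,g\in G$, $j,j'\in\mathbb{N}_0$: $hx^j\cdot gx^{j'}=\lambda(g)^j(h\cdot g)x^j$ and $hx^j\mathbin{:}gx^{j'}=\xi(g)^j(h\mathbin{:}g)x^j$ if $j'=0$, and both are $0$ if $j'>0$. *)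

theory Defs
  imports
    "HOL-Library.Poly_Mapping"
    "HOL-Algebra.Multiplicative_Group"
    "HOL-Computational_Algebra.Polynomial"
begin

section \<open>Vector spaces with a basis and their tensor products\<close>

text \<open>
  A vector space over the field \<open>'k\<close> is given as \<open>'b \<Rightarrow>\<^sub>0 'k\<close>, the space with basis indexed
  by the arbitrary type \<open>'b\<close>; since every vector space has a basis, this is no restriction.
  The tensor product of \<open>'b \<Rightarrow>\<^sub>0 'k\<close> and \<open>'c \<Rightarrow>\<^sub>0 'k\<close> is then \<open>'b \<times> 'c \<Rightarrow>\<^sub>0 'k\<close>.
\<close>

definition vscale :: "'k::field \<Rightarrow> ('b \<Rightarrow>\<^sub>0 'k) \<Rightarrow> ('b \<Rightarrow>\<^sub>0 'k)" where
  "vscale c v = Poly_Mapping.map ((*) c) v"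

lemma lookup_vscale [simp]: "Poly_Mapping.lookup (vscale c v) b = c * Poly_Mapping.lookup v b"
  unfolding vscale_def by transfer (simp add: when_def)

lemma vector_space_vscale: "vector_space (vscale :: 'k::field \<Rightarrow> ('b \<Rightarrow>\<^sub>0 'k) \<Rightarrow> _)"
  by standard (auto intro!: poly_mapping_eqI simp: lookup_add algebra_simps)

abbreviation bvec :: "'b \<Rightarrow> ('b \<Rightarrow>\<^sub>0 'k::field)" where
  "bvec b \<equiv> Poly_Mapping.single b 1"

abbreviation vlinear :: "(('b \<Rightarrow>\<^sub>0 'k::field) \<Rightarrow> ('c \<Rightarrow>\<^sub>0 'k)) \<Rightarrow> bool" where
  "vlinear \<equiv> Vector_Spaces.linear vscale vscale"

definition lin_ext :: "('b \<Rightarrow> ('c \<Rightarrow>\<^sub>0 'k)) \<Rightarrow> ('b \<Rightarrow>\<^sub>0 'k::field) \<Rightarrow> ('c \<Rightarrow>\<^sub>0 'k)" where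
  "lin_ext f v = (\<Sum>b\<in>Poly_Mapping.keys v. vscale (Poly_Mapping.lookup v b) (f b))"

definition tens :: "('b \<Rightarrow>\<^sub>0 'k::field) \<Rightarrow> ('c \<Rightarrow>\<^sub>0 'k) \<Rightarrow> ('b \<times> 'c \<Rightarrow>\<^sub>0 'k)"
    (infixr "\<otimes>\<^sub>k" 75) where
  "u \<otimes>\<^sub>k v = (\<Sum>i\<in>Poly_Mapping.keys u. \<Sum>j\<in>Poly_Mapping.keys v.
     Poly_Mapping.single (i, j) (Poly_Mapping.lookup u i * Poly_Mapping.lookup v j))"

text \<open>\<open>tlin B\<close> is the linear map with \<open>u \<otimes>\<^sub>k v \<mapsto> B u v\<close>, for bilinear \<open>B\<close>.\<close>

definition tlin ::
  "(('b \<Rightarrow>\<^sub>0 'k::field) \<Rightarrow> ('c \<Rightarrow>\<^sub>0 'k) \<Rightarrow> ('d \<Rightarrow>\<^sub>0 'k)) \<Rightarrow> ('b \<times> 'c \<Rightarrow>\<^sub>0 'k) \<Rightarrow> ('d \<Rightarrow>\<^sub>0 'k)" where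
  "tlin B = lin_ext (\<lambda>(i, j). B (bvec i) (bvec j))"


section \<open>Coalgebras and Hopf algebras\<close>

record (overloaded) ('b, 'k) coalg =
  comult :: "('b \<Rightarrow>\<^sub>0 'k) \<Rightarrow> ('b \<times> 'b \<Rightarrow>\<^sub>0 'k)"
  counit :: "('b \<Rightarrow>\<^sub>0 'k) \<Rightarrow> 'k"

text \<open>
  Sweedler notation: \<open>sw C v (\<lambda>v1 v2. F v1 v2)\<close> stands for \<open>F v\<^sub>(\<^sub>1\<^sub>) v\<^sub>(\<^sub>2\<^sub>)\<close>, for \<open>F\<close> bilinear.
\<close>

definition sw :: "('b, 'k::field, 'm) coalg_scheme \<Rightarrow> ('b \<Rightarrow>\<^sub>0 'k) \<Rightarrow>
    (('b \<Rightarrow>\<^sub>0 'k) \<Rightarrow> ('b \<Rightarrow>\<^sub>0 'k) \<Rightarrow> ('c \<Rightarrow>\<^sub>0 'k)) \<Rightarrow> ('c \<Rightarrow>\<^sub>0 'k)" where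
  "sw C v F = tlin F (comult C v)"

locale coalgebra =
  fixes C :: "('b, 'k::field, 'm) coalg_scheme" (structure)
  assumes linear_comult: "vlinear (comult C)"
    and linear_counit: "Vector_Spaces.linear vscale (*) (counit C)"
    and coassoc: "sw C v (\<lambda>v1 v2. sw C v1 (\<lambda>v11 v12. v11 \<otimes>\<^sub>k (v12 \<otimes>\<^sub>k v2))) =
                  sw C v (\<lambda>v1 v2. sw C v2 (\<lambda>v21 v22. v1 \<otimes>\<^sub>k (v21 \<otimes>\<^sub>k v22)))"
    and counit_left: "sw C v (\<lambda>v1 v2. vscale (counit C v1) v2) = v"
    and counit_right: "sw C v (\<lambda>v1 v2. vscale (counit C v2) v1) = v"

definition coalgebra_morphism ::
  "('b, 'k::field, 'm) coalg_scheme \<Rightarrow> ('c, 'k, 'n) coalg_scheme \<Rightarrow>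
    (('b \<Rightarrow>\<^sub>0 'k) \<Rightarrow> ('c \<Rightarrow>\<^sub>0 'k)) \<Rightarrow> bool" where
  "coalgebra_morphism C D f \<longleftrightarrow> vlinear f \<and>
     (\<forall>v. comult D (f v) = sw C v (\<lambda>v1 v2. f v1 \<otimes>\<^sub>k f v2)) \<and>
     (\<forall>v. counit D (f v) = counit C v)"

definition cop :: "('b, 'k::field, 'm) coalg_scheme \<Rightarrow> ('b, 'k) coalg" where
  "cop C = \<lparr>comult = (\<lambda>v. sw C v (\<lambda>v1 v2. v2 \<otimes>\<^sub>k v1)), counit = counit C\<rparr>"

definition tensor_coalg ::
  "('b, 'k::field, 'm) coalg_scheme \<Rightarrow> ('c, 'k, 'n) coalg_scheme \<Rightarrow> ('b \<times> 'c, 'k) coalg" where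
  "tensor_coalg C D =
    \<lparr>comult = tlin (\<lambda>u v. sw C u (\<lambda>u1 u2. sw D v (\<lambda>v1 v2. (u1 \<otimes>\<^sub>k v1) \<otimes>\<^sub>k (u2 \<otimes>\<^sub>k v2)))),
     counit = (\<lambda>t. \<Sum>(i, j)\<in>Poly_Mapping.keys t.
       Poly_Mapping.lookup t (i, j) * (counit C (bvec i) * counit D (bvec j)))\<rparr>"

record (overloaded) ('b, 'k) hopf = "('b, 'k) coalg" +
  hmult :: "('b \<Rightarrow>\<^sub>0 'k) \<Rightarrow> ('b \<Rightarrow>\<^sub>0 'k) \<Rightarrow> ('b \<Rightarrow>\<^sub>0 'k)" (infixl "\<star>\<index>" 78)
  hone :: "'b \<Rightarrow>\<^sub>0 'k" ("\<eta>\<index>")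

locale hopf_algebra = coalgebra H
  for H :: "('b, 'k::field, 'm) hopf_scheme" (structure) +
  assumes mult_linear_right: "vlinear (\<lambda>v. u \<star> v)"
    and mult_linear_left: "vlinear (\<lambda>u. u \<star> v)"
    and mult_assoc: "(u \<star> v) \<star> w = u \<star> (v \<star> w)"
    and one_left: "\<eta> \<star> u = u"
    and one_right: "u \<star> \<eta> = u"
    and comult_mult: "comult H (u \<star> v) =
      sw H u (\<lambda>u1 u2. sw H v (\<lambda>v1 v2. (u1 \<star> v1) \<otimes>\<^sub>k (u2 \<star> v2)))"
    and comult_one: "comult H \<eta> = \<eta> \<otimes>\<^sub>k \<eta>"
    and counit_mult: "counit H (u \<star> v) = counit H u * counit H v"
    and counit_one: "counit H \<eta> = 1"
    and ex_antipode: "\<exists>S. vlinear S \<and>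
      (\<forall>h. sw H h (\<lambda>h1 h2. S h1 \<star> h2) = vscale (counit H h) \<eta>) \<and>
      (\<forall>h. sw H h (\<lambda>h1 h2. h1 \<star> S h2) = vscale (counit H h) \<eta>)"

text \<open>A bialgebra morphism between Hopf algebras commutes with the antipodes.\<close>

definition hopf_morphism ::
  "('b, 'k::field, 'm) hopf_scheme \<Rightarrow> ('c, 'k, 'n) hopf_scheme \<Rightarrow>
    (('b \<Rightarrow>\<^sub>0 'k) \<Rightarrow> ('c \<Rightarrow>\<^sub>0 'k)) \<Rightarrow> bool" where
  "hopf_morphism H K F \<longleftrightarrow> coalgebra_morphism H K F \<and>
     (\<forall>u v. F (u \<star>\<^bsub>H\<^esub> v) = F u \<star>\<^bsub>K\<^esub> F v) \<and> F \<eta>\<^bsub>H\<^esub> = \<eta>\<^bsub>K\<^esub>"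

definition hopf_iso ::
  "('b, 'k::field, 'm) hopf_scheme \<Rightarrow> ('c, 'k, 'n) hopf_scheme \<Rightarrow>
    (('b \<Rightarrow>\<^sub>0 'k) \<Rightarrow> ('c \<Rightarrow>\<^sub>0 'k)) \<Rightarrow> bool" where
  "hopf_iso H K F \<longleftrightarrow> hopf_morphism H K F \<and> bij F"


section \<open>Hopf q-braces\<close>

text \<open>In the following locales \<open>x \<cdot> y\<close> is \<open>p (x \<otimes> y)\<close> and \<open>x \<Colon> y\<close> is \<open>d (x \<otimes> y)\<close>.\<close>

locale q_magma_coalgebra = coalgebra C
  for C :: "('b, 'k::field, 'm) coalg_scheme" (structure)
    and p d :: "('b \<times> 'b \<Rightarrow>\<^sub>0 'k) \<Rightarrow> ('b \<Rightarrow>\<^sub>0 'k)" +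
  assumes linear_p: "vlinear p"
    and linear_d: "vlinear d"
    and counit_p: "counit C (p (x \<otimes>\<^sub>k y)) = counit C x * counit C y"
    and counit_d: "counit C (d (x \<otimes>\<^sub>k y)) = counit C x * counit C y"
    and q_magma: "coalgebra_morphism (tensor_coalg C (cop C)) (tensor_coalg (cop C) C)
      (tlin (\<lambda>x y. sw C x (\<lambda>x1 x2. sw C y (\<lambda>y1 y2. d (y1 \<otimes>\<^sub>k x2) \<otimes>\<^sub>k p (x1 \<otimes>\<^sub>k y2)))))"
begin

definition dot (infixl "\<cdot>" 77) where "x \<cdot> y = p (x \<otimes>\<^sub>k y)"

definition colon (infixl "\<Colon>" 77) where "x \<Colon> y = d (x \<otimes>\<^sub>k y)"

definition left_regular :: bool where
  "left_regular \<longleftrightarrow> bij (tlin (\<lambda>x y. sw C y (\<lambda>y1 y2. (x \<cdot> y1) \<otimes>\<^sub>k y2)))"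

definition right_regular :: bool where
  "right_regular \<longleftrightarrow> bij (tlin (\<lambda>x y. sw C y (\<lambda>y1 y2. (x \<Colon> y2) \<otimes>\<^sub>k y1)))"

end

locale q_cycle_coalgebra = q_magma_coalgebra +
  assumes left_regular: left_regular
    and q_cycle_1: "sw C v (\<lambda>v1 v2. (u \<cdot> v1) \<cdot> (w \<Colon> v2)) = sw C w (\<lambda>w1 w2. (u \<cdot> w2) \<cdot> (v \<cdot> w1))"
    and q_cycle_2: "sw C v (\<lambda>v1 v2. (u \<cdot> v1) \<Colon> (w \<cdot> v2)) = sw C w (\<lambda>w1 w2. (u \<Colon> w2) \<cdot> (v \<Colon> w1))"
    and q_cycle_3: "sw C v (\<lambda>v1 v2. (u \<Colon> v1) \<Colon> (w \<Colon> v2)) = sw C w (\<lambda>w1 w2. (u \<Colon> w2) \<Colon> (v \<cdot> w1))"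

locale hopf_q_brace = hopf_algebra H + q_cycle_coalgebra H p d
  for H :: "('b, 'k::field, 'm) hopf_scheme" (structure)
    and p d :: "('b \<times> 'b \<Rightarrow>\<^sub>0 'k) \<Rightarrow> ('b \<Rightarrow>\<^sub>0 'k)" +
  assumes right_regular: right_regular
    and dot_one: "h \<cdot> \<eta> = h"
    and dot_mult: "h \<cdot> (k \<star> l) = (h \<cdot> l) \<cdot> k"
    and colon_one: "h \<Colon> \<eta> = h"
    and colon_mult: "h \<Colon> (k \<star> l) = (h \<Colon> l) \<Colon> k"
    and mult_dot: "(h \<star> k) \<cdot> l =
      sw H k (\<lambda>k1 k2. sw H l (\<lambda>l1 l2. (h \<cdot> (l1 \<Colon> k2)) \<star> (k1 \<cdot> l2)))"
    and mult_colon: "(h \<star> k) \<Colon> l =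
      sw H k (\<lambda>k1 k2. sw H l (\<lambda>l1 l2. (h \<Colon> (l1 \<cdot> k2)) \<star> (k1 \<Colon> l2)))"

definition hopf_q_brace_morphism where
  "hopf_q_brace_morphism H p d K p' d' F \<longleftrightarrow> hopf_morphism H K F \<and>
     (\<forall>u v. F (p (u \<otimes>\<^sub>k v)) = p' (F u \<otimes>\<^sub>k F v)) \<and>
     (\<forall>u v. F (d (u \<otimes>\<^sub>k v)) = d' (F u \<otimes>\<^sub>k F v))"

definition hopf_q_brace_iso where
  "hopf_q_brace_iso H p d K p' d' F \<longleftrightarrow> hopf_q_brace_morphism H p d K p' d' F \<and> bij F"

definition q_brace_iso ::
  "('g, 'm) monoid_scheme \<Rightarrow> ('g \<Rightarrow> 'g \<Rightarrow> 'g) \<Rightarrow> ('g \<Rightarrow> 'g \<Rightarrow> 'g) \<Rightarrow>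
   ('h, 'n) monoid_scheme \<Rightarrow> ('h \<Rightarrow> 'h \<Rightarrow> 'h) \<Rightarrow> ('h \<Rightarrow> 'h \<Rightarrow> 'h) \<Rightarrow> ('g \<Rightarrow> 'h) \<Rightarrow> bool" where
  "q_brace_iso G dt cl G' dt' cl' f \<longleftrightarrow> f \<in> Group.iso G G' \<and>
     (\<forall>g\<in>carrier G. \<forall>h\<in>carrier G. f (dt g h) = dt' (f g) (f h)) \<and>
     (\<forall>g\<in>carrier G. \<forall>h\<in>carrier G. f (cl g h) = cl' (f g) (f h))"


section \<open>Algebras given by generators and relations\<close>

text \<open>
  \<open>word_alg S\<close> is the free algebra on \<open>S\<close>: it has the words in \<open>S\<close> as a basis.
\<close>

definition word_alg :: "'s set \<Rightarrow> ('s list \<Rightarrow>\<^sub>0 'k::field) set" where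
  "word_alg S = {u. Poly_Mapping.keys u \<subseteq> lists S}"

definition word_mult :: "('s list \<Rightarrow>\<^sub>0 'k::field) \<Rightarrow> ('s list \<Rightarrow>\<^sub>0 'k) \<Rightarrow> ('s list \<Rightarrow>\<^sub>0 'k)" where
  "word_mult u v = lin_ext (\<lambda>(s, t). bvec (s @ t)) (u \<otimes>\<^sub>k v)"

definition word_ideal :: "'s set \<Rightarrow> ('s list \<Rightarrow>\<^sub>0 'k::field) set \<Rightarrow> bool" where
  "word_ideal S I \<longleftrightarrow> I \<subseteq> word_alg S \<and> module.subspace vscale I \<and>
     (\<forall>u\<in>word_alg S. \<forall>v\<in>I. word_mult u v \<in> I \<and> word_mult v u \<in> I)"

definition ideal_generated :: "'s set \<Rightarrow> ('s list \<Rightarrow>\<^sub>0 'k::field) set \<Rightarrow> ('s list \<Rightarrow>\<^sub>0 'k) set" where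
  "ideal_generated S R = \<Inter> {I. word_ideal S I \<and> R \<subseteq> I}"

definition word_eval :: "('b, 'k::field, 'm) hopf_scheme \<Rightarrow> ('s \<Rightarrow> ('b \<Rightarrow>\<^sub>0 'k)) \<Rightarrow>
    ('s list \<Rightarrow>\<^sub>0 'k) \<Rightarrow> ('b \<Rightarrow>\<^sub>0 'k)" where
  "word_eval H e = lin_ext (\<lambda>w. foldr (\<lambda>s v. e s \<star>\<^bsub>H\<^esub> v) w \<eta>\<^bsub>H\<^esub>)"

text \<open>
  The algebra \<open>H\<close> is generated by the elements \<open>e s\<close>, \<open>s \<in> S\<close>, subject to the relations \<open>r = 0\<close>,
  \<open>r \<in> R\<close>: the canonical map from the free algebra is onto, and its kernel is the ideal generated
  by \<open>R\<close>.
\<close>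

definition presented_by :: "('b, 'k::field, 'm) hopf_scheme \<Rightarrow> 's set \<Rightarrow> ('s \<Rightarrow> ('b \<Rightarrow>\<^sub>0 'k)) \<Rightarrow>
    ('s list \<Rightarrow>\<^sub>0 'k) set \<Rightarrow> bool" where
  "presented_by H S e R \<longleftrightarrow>
     word_eval H e ` word_alg S = UNIV \<and>
     {u \<in> word_alg S. word_eval H e u = 0} = ideal_generated S R"


section \<open>Rank one pointed Hopf algebras\<close>

definition field_units :: "'k::field monoid" where
  "field_units = \<lparr>carrier = {c. c \<noteq> 0}, monoid.mult = (*), one = 1\<rparr>"

lemma group_field_units: "group (field_units :: 'k::field monoid)"
proof (rule groupI)
  fix c :: 'k assume "c \<in> carrier field_units"
  then show "\<exists>b\<in>carrier field_units. b \<otimes>\<^bsub>field_units\<^esub> c = \<one>\<^bsub>field_units\<^esub>"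
    by (intro bexI[of _ "inverse c"]) (auto simp: field_units_def)
qed (auto simp: field_units_def)

abbreviation characters :: "('g, 'm) monoid_scheme \<Rightarrow> ('g \<Rightarrow> 'k::field) set" where
  "characters G \<equiv> hom G field_units"

record ('g, 'k) rank_one_data =
  Grp :: "'g monoid"
  Chi :: "'g \<Rightarrow> 'k"
  Elt :: "'g"
  Alpha :: "'k"

definition chi_order :: "('g, 'k::field) rank_one_data \<Rightarrow> nat" where
  "chi_order D = group.ord field_units (Chi D (Elt D))"

text \<open>
  The group algebra of \<open>G\<close> consists of the elements of \<open>'g \<Rightarrow>\<^sub>0 'k\<close> supported in \<open>carrier G\<close>.
\<close>

locale rank_one_datum =
  fixes D :: "('g, 'k::field) rank_one_data"
  assumes group: "group (Grp D)"
    and finite: "finite (carrier (Grp D))"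
    and character: "Chi D \<in> characters (Grp D)"
    and elt: "Elt D \<in> carrier (Grp D)"
    and central: "g \<in> carrier (Grp D) \<Longrightarrow> Elt D \<otimes>\<^bsub>Grp D\<^esub> g = g \<otimes>\<^bsub>Grp D\<^esub> Elt D"
    and order_gt_1: "chi_order D > 1"
    and compatible:
      "vscale (Alpha D) (bvec (Elt D [^]\<^bsub>Grp D\<^esub> chi_order D) - bvec \<one>\<^bsub>Grp D\<^esub>) = 0 \<or>
       (\<forall>g\<in>carrier (Grp D). Chi D g ^ chi_order D = 1)"

datatype 'g generator = Gen 'g | X

definition generators :: "('g, 'm) monoid_scheme \<Rightarrow> 'g generator set" where
  "generators G = insert X (Gen ` carrier G)"

definition relations :: "('g, 'k::field) rank_one_data \<Rightarrow> ('g generator list \<Rightarrow>\<^sub>0 'k) set" where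
  "relations D =
    {bvec [Gen g, Gen h] - bvec [Gen (g \<otimes>\<^bsub>Grp D\<^esub> h)] | g h.
       g \<in> carrier (Grp D) \<and> h \<in> carrier (Grp D)} \<union>
    {bvec [Gen \<one>\<^bsub>Grp D\<^esub>] - bvec []} \<union>
    {bvec (replicate (chi_order D) X) -
       vscale (Alpha D) (bvec (replicate (chi_order D) (Gen (Elt D))) - bvec [])} \<union>
    {bvec [X, Gen g] - vscale (Chi D g) (bvec [Gen g, X]) | g. g \<in> carrier (Grp D)}"

text \<open>
  \<open>H\<close> is (a model of) the Hopf algebra of the datum \<open>D\<close>, with \<open>\<iota>\<close> the canonical map from the group
  to \<open>H\<close>, and \<open>x\<close> the skew-primitive generator.
\<close>

locale rank_one_hopf_algebra = rank_one_datum D + hopf_algebra H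
  for D :: "('g, 'k::field) rank_one_data"
    and H :: "('b, 'k, 'm) hopf_scheme" (structure)
    and \<iota> :: "'g \<Rightarrow> ('b \<Rightarrow>\<^sub>0 'k)"
    and x :: "'b \<Rightarrow>\<^sub>0 'k" +
  assumes presentation:
      "presented_by H (generators (Grp D)) (case_generator \<iota> x) (relations D)"
    and comult_group: "g \<in> carrier (Grp D) \<Longrightarrow> comult H (\<iota> g) = \<iota> g \<otimes>\<^sub>k \<iota> g"
    and comult_x: "comult H x = x \<otimes>\<^sub>k \<iota> (Elt D) + \<eta> \<otimes>\<^sub>k x"

text \<open>
  The binary operation on \<open>G\<close> obtained by restricting \<open>p\<close> to the image of \<open>\<iota>\<close>; for a Hopf q-brace
  on \<open>H\<close> this image, the set of group-likes, is closed under both operations.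
\<close>

definition restrict_op :: "('g, 'n) monoid_scheme \<Rightarrow> ('g \<Rightarrow> ('b \<Rightarrow>\<^sub>0 'k::field)) \<Rightarrow>
    (('b \<times> 'b \<Rightarrow>\<^sub>0 'k) \<Rightarrow> ('b \<Rightarrow>\<^sub>0 'k)) \<Rightarrow> 'g \<Rightarrow> 'g \<Rightarrow> 'g" where
  "restrict_op G \<iota> p g h = the_inv_into (carrier G) \<iota> (p (\<iota> g \<otimes>\<^sub>k \<iota> h))"

end

theory Submission
  imports Defs
begin

text \<open>
  A Hopf q-brace on \<open>H\<^sub>D\<close> with \<open>x \<cdot> x = x : x = 0\<close> is determined by its restriction to \<open>G\<close> and the
  two characters \<open>\<lambda>\<close> and \<open>\<xi>\<close>, and an isomorphism of Hopf algebras rescales the generator \<open>x\<close>.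
  The equivalence is a consequence of these two facts.

  The first fact. The operations are coalgebra morphisms up to a flip, and they commute with each other
  in the sense of the exchange identity
  \<open>y\<^sub>(\<^sub>1\<^sub>) : x\<^sub>(\<^sub>2\<^sub>) \<otimes> x\<^sub>(\<^sub>1\<^sub>) \<cdot> y\<^sub>(\<^sub>2\<^sub>) = y\<^sub>(\<^sub>2\<^sub>) : x\<^sub>(\<^sub>1\<^sub>) \<otimes> x\<^sub>(\<^sub>2\<^sub>) \<cdot> y\<^sub>(\<^sub>1\<^sub>)\<close>.
  Evaluated at \<open>g \<otimes> x\<close> with \<open>g \<in> G\<close>, this identity yields \<open>g \<cdot> x = 0\<close> and \<open>g \<cdot> a = g\<close>
  (\<open>dt_group_x_and_elt\<close>). The compatibility of the operations with the multiplication then gives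
  \<open>ux \<cdot> g = \<lambda>(g) (u \<cdot> g) x\<close> (\<open>dt_mult_x_group\<close>) and \<open>u \<cdot> x = 0\<close> (\<open>dt_x\<close>) for all \<open>u\<close>,
  and the module property gives \<open>u \<cdot> vx = 0\<close>. The situation is symmetric in the two operations.

  The second fact. The image \<open>F x\<close> is skew-primitive, and it commutes with the group-like \<open>f a\<close> up to
  the scalar \<open>\<chi>(a) \<noteq> 1\<close>; such elements are multiples of \<open>x'\<close> (\<open>skew_primitive_multiple_of_x\<close>).

  Both facts rely on the basis \<open>g x\<^sup>m\<close> of \<open>H\<^sub>D\<close>. Starting from generators and relations, its linear
  independence is obtained from an explicit module (\<open>model_rep\<close>). The comultiplication in this basis has
  Gaussian binomials as coefficients, and comparing coordinates shows that the group-likes are the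
  elements of \<open>G\<close> (\<open>grouplike_in_group\<close>), so that the operations restrict to \<open>G\<close>, and describes
  the skew-primitives.
\<close>

section \<open>Linear extension and tensor products\<close>

lemma vlinearI:
  assumes "\<And>u v. f (u + v) = f u + f v" "\<And>c v. f (vscale c v) = vscale c (f v)"
  shows "vlinear f"
  using assms by (simp add: Vector_Spaces.linear_iff vector_space_vscale)

lemma vlinear_add: "vlinear f \<Longrightarrow> f (u + v) = f u + f v"
  and vlinear_scale: "vlinear f \<Longrightarrow> f (vscale c v) = vscale c (f v)"
  by (simp_all add: Vector_Spaces.linear_iff)

lemma vscale_simps [simp]: "vscale 0 v = 0" "vscale c 0 = 0" "vscale 1 v = v"
  "vscale c (vscale c' v) = vscale (c * c') v"
  by (auto intro!: poly_mapping_eqI simp: algebra_simps)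

lemma vscale_add: "vscale c (u + v) = vscale c u + vscale c v"
  and vscale_diff: "vscale c (u - v) = vscale c u - vscale c v"
  and vscale_add_left: "vscale (c + c') v = vscale c v + vscale c' v"
  by (auto intro!: poly_mapping_eqI simp: lookup_add lookup_minus algebra_simps)

lemma vscale_sum: "vscale c (sum f A) = (\<Sum>a\<in>A. vscale c (f a))"
  by (induction A rule: infinite_finite_induct) (auto simp: vscale_add)

lemma vscale_minus_one: "vscale (-1) v = - v"
  by (auto intro!: poly_mapping_eqI)

lemma vscale_eq_0_iff: "vscale c v = 0 \<longleftrightarrow> c = 0 \<or> v = 0"
proof
  assume *: "vscale c v = 0"
  have "c * Poly_Mapping.lookup v b = 0" for b
    using arg_cong[OF *, of "\<lambda>w. Poly_Mapping.lookup w b"] by simp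
  then show "c = 0 \<or> v = 0"
    by (auto intro!: poly_mapping_eqI)
qed auto

lemma vlinear_0: "vlinear f \<Longrightarrow> f 0 = 0"
  using vlinear_scale[of f 0 0] by simp

lemma vlinear_diff: "vlinear f \<Longrightarrow> f (u - v) = f u - f v"
  using vlinear_add[of f u "vscale (-1) v"] vlinear_scale[of f "-1" v]
  by (simp add: vscale_minus_one)

lemma vlinear_sum: "vlinear f \<Longrightarrow> f (sum g A) = (\<Sum>a\<in>A. f (g a))"
  by (induction A rule: infinite_finite_induct) (auto simp: vlinear_0 vlinear_add)

lemma vlinear_comp: "vlinear f \<Longrightarrow> vlinear g \<Longrightarrow> vlinear (\<lambda>v. g (f v))"
  by (auto intro!: vlinearI simp: vlinear_add vlinear_scale)

lemma vlinear_vscale: "vlinear (vscale c)"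
  by (rule vlinearI) (auto simp: vscale_add algebra_simps)

lemma vlinear_id: "vlinear (\<lambda>v. v)"
  by (rule vlinearI) auto

lemma vlinear_plus: "vlinear f \<Longrightarrow> vlinear g \<Longrightarrow> vlinear (\<lambda>v. f v + g v)"
  by (rule vlinearI) (auto simp: vlinear_add vlinear_scale vscale_add)

lemma vlinear_vscale_functional:
  assumes "Vector_Spaces.linear vscale (*) e"
  shows "vlinear (\<lambda>v. vscale (e v) w)"
  using assms
  by (simp add: Vector_Spaces.linear_iff vscale_add_left vector_space_vscale)

lemma lin_ext_superset:
  assumes "finite S" "Poly_Mapping.keys v \<subseteq> S"
  shows "lin_ext f v = (\<Sum>b\<in>S. vscale (Poly_Mapping.lookup v b) (f b))"
  unfolding lin_ext_def
  by (rule sum.mono_neutral_left) (use assms in \<open>auto simp: in_keys_iff\<close>)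

lemma vlinear_lin_ext:
  fixes f :: "'b \<Rightarrow> ('c \<Rightarrow>\<^sub>0 'k::field)"
  shows "vlinear (lin_ext f)"
proof (rule vlinearI)
  fix u v :: "'b \<Rightarrow>\<^sub>0 'k"
  let ?S = "Poly_Mapping.keys u \<union> Poly_Mapping.keys v"
  have "Poly_Mapping.keys (u + v) \<subseteq> ?S" by (rule Poly_Mapping.keys_add)
  then show "lin_ext f (u + v) = lin_ext f u + lin_ext f v"
    by (subst (1 2 3) lin_ext_superset[of ?S])
      (auto simp: lookup_add vscale_add_left sum.distrib)
next
  fix c and v :: "'b \<Rightarrow>\<^sub>0 'k"
  have "Poly_Mapping.keys (vscale c v) \<subseteq> Poly_Mapping.keys v"
    by (auto simp: in_keys_iff)
  then show "lin_ext f (vscale c v) = vscale c (lin_ext f v)"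
    by (subst (1 2) lin_ext_superset[of "Poly_Mapping.keys v"]) (auto simp: vscale_sum)
qed

lemma lin_ext_bvec [simp]: "lin_ext f (bvec b) = f b"
  by (simp add: lin_ext_def)

lemma lin_ext_bvec_id: "lin_ext bvec v = v"
  by (rule poly_mapping_eqI)
    (auto simp: lin_ext_def lookup_sum lookup_single when_def in_keys_iff if_distrib cong: if_cong)

lemma vlinear_lin_ext_comp: "vlinear g \<Longrightarrow> g (lin_ext f v) = lin_ext (\<lambda>b. g (f b)) v"
  by (simp add: lin_ext_def vlinear_sum vlinear_scale)

lemma vlinear_eqI:
  assumes "vlinear f" "vlinear g" "\<And>b. f (bvec b) = g (bvec b)"
  shows "f v = g v"
  using vlinear_lin_ext_comp[OF assms(1), of bvec v] vlinear_lin_ext_comp[OF assms(2), of bvec v]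
  by (simp add: lin_ext_bvec_id assms(3))

lemma lin_ext_cong: "(\<And>b. b \<in> Poly_Mapping.keys v \<Longrightarrow> f b = g b) \<Longrightarrow> lin_ext f v = lin_ext g v"
  by (simp add: lin_ext_def)

lemma vlinear_lin_ext_param:
  "(\<And>b. vlinear (g b)) \<Longrightarrow> vlinear (\<lambda>v. lin_ext (\<lambda>b. g b v) u)"
  by (rule vlinearI)
    (simp_all add: lin_ext_def vlinear_add vlinear_scale vscale_add sum.distrib vscale_sum
      mult.commute)

definition vbilinear where
  "vbilinear B \<longleftrightarrow> (\<forall>v. vlinear (\<lambda>u. B u v)) \<and> (\<forall>u. vlinear (B u))"

lemma vbilinearI:
  "(\<And>v. vlinear (\<lambda>u. B u v)) \<Longrightarrow> (\<And>u. vlinear (B u)) \<Longrightarrow> vbilinear B"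
  by (auto simp: vbilinear_def)

lemma vbilinearD: "vbilinear B \<Longrightarrow> vlinear (\<lambda>u. B u v)" "vbilinear B \<Longrightarrow> vlinear (B u)"
  by (auto simp: vbilinear_def)

lemma vbilinear_simps:
  assumes "vbilinear B"
  shows "B (u + u') v = B u v + B u' v" "B u (v + v') = B u v + B u v'"
    "B (vscale c u) v = vscale c (B u v)" "B u (vscale c v) = vscale c (B u v)"
    "B 0 v = 0" "B u 0 = 0" "B (u - u') v = B u v - B u' v" "B u (v - v') = B u v - B u v'"
  using vbilinearD[OF assms]
  by (auto simp: vlinear_add[where f="\<lambda>u. B u _"] vlinear_scale[where f="\<lambda>u. B u _"]
      vlinear_add vlinear_scale vlinear_0 vlinear_0[where f="\<lambda>u. B u _"]
      vlinear_diff vlinear_diff[where f="\<lambda>u. B u _"])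

lemma vbilinear_comp: "vbilinear B \<Longrightarrow> vlinear g \<Longrightarrow> vbilinear (\<lambda>u v. g (B u v))"
  by (auto simp: vbilinear_def intro: vlinear_comp)

lemma vbilinear_comp2:
  assumes "vbilinear B" "vlinear f" "vlinear g"
  shows "vbilinear (\<lambda>u v. B (f u) (g v))"
  using assms vlinear_comp[of g "B _"] vlinear_comp[of f "\<lambda>u. B u _"]
  by (auto simp: vbilinear_def)

lemma vbilinear_flip: "vbilinear B \<Longrightarrow> vbilinear (\<lambda>u v. B v u)"
  by (auto simp: vbilinear_def)

lemma vbilinear_plus: "vbilinear B \<Longrightarrow> vbilinear B' \<Longrightarrow> vbilinear (\<lambda>u v. B u v + B' u v)"
  by (auto simp: vbilinear_def intro: vlinear_plus)

lemma lookup_tens [simp]: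
  "Poly_Mapping.lookup (u \<otimes>\<^sub>k v) (i, j) = Poly_Mapping.lookup u i * Poly_Mapping.lookup v j"
proof -
  have "Poly_Mapping.lookup (u \<otimes>\<^sub>k v) (i, j) =
    (\<Sum>i'\<in>Poly_Mapping.keys u. if i' = i then \<Sum>j'\<in>Poly_Mapping.keys v.
      if j' = j then Poly_Mapping.lookup u i * Poly_Mapping.lookup v j else 0 else 0)"
    unfolding tens_def lookup_sum
    by (intro sum.cong refl)
      (auto intro!: sum.cong simp: lookup_single when_def simp del: sum.delta sum.delta')
  also have "\<dots> = (if i \<in> Poly_Mapping.keys u then if j \<in> Poly_Mapping.keys v
      then Poly_Mapping.lookup u i * Poly_Mapping.lookup v j else 0 else 0)"
    by simp
  finally show ?thesis
    by (auto simp: in_keys_iff split: if_splits)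
qed

lemma vbilinear_tens: "vbilinear (\<otimes>\<^sub>k)"
  by (intro vbilinearI vlinearI poly_mapping_eqI)
    (auto simp: lookup_add algebra_simps split_paired_all)

lemmas tens_simps = vbilinear_simps[OF vbilinear_tens]

lemma tens_bvec [simp]: "bvec i \<otimes>\<^sub>k bvec j = bvec (i, j)"
  by (auto intro!: poly_mapping_eqI simp: lookup_single when_def split_paired_all)

lemma tlin_bvec [simp]: "tlin B (bvec (i, j)) = B (bvec i) (bvec j)"
  by (simp add: tlin_def)

lemma vlinear_tlin: "vlinear (tlin B)"
  unfolding tlin_def by (rule vlinear_lin_ext)

lemma vbilinear_eqI:
  assumes "vbilinear A" "vbilinear B" "\<And>i j. A (bvec i) (bvec j) = B (bvec i) (bvec j)"
  shows "A u v = B u v"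
proof (rule vlinear_eqI[of "\<lambda>u. A u v" "\<lambda>u. B u v"])
  fix i show "A (bvec i) v = B (bvec i) v"
    by (rule vlinear_eqI) (use assms in \<open>auto simp: vbilinear_def\<close>)
qed (use assms in \<open>auto simp: vbilinear_def\<close>)

text \<open>
  Values of \<open>tlin B\<close> on basis tensors are correct by definition for every \<open>B\<close>; bilinearity is what
  carries this over to arbitrary pure tensors. Hence an identity between Sweedler expressions can be
  checked on basis vectors before any bilinearity has to be established.
\<close>

lemma tlin_tens: "vbilinear B \<Longrightarrow> tlin B (u \<otimes>\<^sub>k v) = B u v"
  by (rule vbilinear_eqI[of "\<lambda>u v. tlin B (u \<otimes>\<^sub>k v)"])
    (auto intro: vbilinear_comp[OF vbilinear_tens vlinear_tlin])

lemma tlin_comp: "vlinear g \<Longrightarrow> g (tlin B t) = tlin (\<lambda>u v. g (B u v)) t"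
  by (simp add: tlin_def vlinear_lin_ext_comp case_prod_unfold)

lemma tlin_cong:
  "(\<And>i j. A (bvec i) (bvec j) = B (bvec i) (bvec j)) \<Longrightarrow> tlin A = tlin B"
  by (simp add: tlin_def)

lemma vlinear_tlin_param:
  "(\<And>u u'. vlinear (B u u')) \<Longrightarrow> vlinear (\<lambda>v. tlin (\<lambda>u u'. B u u' v) t)"
  unfolding tlin_def case_prod_unfold by (rule vlinear_lin_ext_param) auto

lemma tlin_eqI:
  assumes "vlinear f" "vlinear g" "\<And>i j. f (bvec (i, j)) = g (bvec (i, j))"
  shows "f t = g t"
  by (rule vlinear_eqI) (use assms in auto)

section \<open>Sweedler notation\<close>

lemma sw_comp: "vlinear g \<Longrightarrow> g (sw C v B) = sw C v (\<lambda>v1 v2. g (B v1 v2))"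
  by (simp add: sw_def tlin_comp)

lemma sw_cong:
  "(\<And>i j. A (bvec i) (bvec j) = B (bvec i) (bvec j)) \<Longrightarrow> sw C v A = sw C v B"
  using tlin_cong[of A B] by (simp add: sw_def)

lemma vlinear_sw_param:
  "(\<And>u u'. vlinear (B u u')) \<Longrightarrow> vlinear (\<lambda>v. sw C w (\<lambda>u u'. B u u' v))"
  unfolding sw_def by (rule vlinear_tlin_param)

lemma sw_tens: "comult C v = u \<otimes>\<^sub>k w \<Longrightarrow> vbilinear B \<Longrightarrow> sw C v B = B u w"
  by (simp add: sw_def tlin_tens)

lemma sw_tens_add:
  "comult C v = u \<otimes>\<^sub>k w + u' \<otimes>\<^sub>k w' \<Longrightarrow> vbilinear B \<Longrightarrow> sw C v B = B u w + B u' w'"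
  by (simp add: sw_def tlin_tens vlinear_add[OF vlinear_tlin])

lemma sw_cop: "sw (cop C) v B = sw C v (\<lambda>v1 v2. B v2 v1)"
proof -
  have "sw (cop C) v B = tlin B (sw C v (\<lambda>v1 v2. v2 \<otimes>\<^sub>k v1))"
    by (simp add: sw_def cop_def)
  also have "\<dots> = sw C v (\<lambda>v1 v2. tlin B (v2 \<otimes>\<^sub>k v1))"
    by (rule sw_comp[OF vlinear_tlin])
  also have "\<dots> = sw C v (\<lambda>v1 v2. B v2 v1)"
    by (rule sw_cong) simp
  finally show ?thesis .
qed

context coalgebra
begin

lemma vlinear_sw: "vlinear (\<lambda>v. sw C v B)"
  unfolding sw_def by (intro vlinear_comp[OF linear_comult] vlinear_tlin)

lemma vlinear_counit: "vlinear (\<lambda>v. vscale (counit C v) w)"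
  by (rule vlinear_vscale_functional[OF linear_counit])

lemma counit_simps: "counit C (u + v) = counit C u + counit C v"
    "counit C (vscale c v) = c * counit C v"
  using linear_counit by (auto simp: Vector_Spaces.linear_iff)

lemma vbilinear_counit: "vbilinear (\<lambda>u v. vscale (counit C u) v)"
  by (intro vbilinearI vlinear_counit vlinear_vscale)

end

section \<open>Consequences of the q-magma condition\<close>

lemma tlin_tens_id: "tlin (\<otimes>\<^sub>k) t = t"
  by (rule tlin_eqI[OF vlinear_tlin vlinear_id]) simp

lemma sw_tens_id: "sw C v (\<otimes>\<^sub>k) = comult C v"
  by (simp add: sw_def tlin_tens_id)

lemma comult_tensor_coalg_bvec:
  "comult (tensor_coalg C D) (bvec (i, j)) =
    sw C (bvec i) (\<lambda>u1 u2. sw D (bvec j) (\<lambda>v1 v2. (u1 \<otimes>\<^sub>k v1) \<otimes>\<^sub>k (u2 \<otimes>\<^sub>k v2)))"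
  by (simp add: tensor_coalg_def)

lemma sw_tensor_coalg_bvec:
  "sw (tensor_coalg C D) (bvec (i, j)) B =
    sw C (bvec i) (\<lambda>u1 u2. sw D (bvec j) (\<lambda>v1 v2. B (u1 \<otimes>\<^sub>k v1) (u2 \<otimes>\<^sub>k v2)))"
proof -
  have "sw (tensor_coalg C D) (bvec (i, j)) B =
    sw C (bvec i) (\<lambda>u1 u2. sw D (bvec j) (\<lambda>v1 v2. tlin B ((u1 \<otimes>\<^sub>k v1) \<otimes>\<^sub>k (u2 \<otimes>\<^sub>k v2))))"
    unfolding sw_def[of "tensor_coalg C D"] comult_tensor_coalg_bvec
    by (simp add: sw_comp[OF vlinear_tlin])
  also have "\<dots> = sw C (bvec i) (\<lambda>u1 u2. sw D (bvec j) (\<lambda>v1 v2. B (u1 \<otimes>\<^sub>k v1) (u2 \<otimes>\<^sub>k v2)))"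
    by (intro sw_cong) simp
  finally show ?thesis .
qed

text \<open>
  Two Sweedler sums over different elements are finite sums, so they commute without any linearity
  assumption on \<open>B\<close>.
\<close>

lemma sw_swap:
  "sw C u (\<lambda>u1 u2. sw D v (\<lambda>v1 v2. B u1 u2 v1 v2)) =
    sw D v (\<lambda>v1 v2. sw C u (\<lambda>u1 u2. B u1 u2 v1 v2))"
  unfolding sw_def tlin_def lin_ext_def case_prod_unfold vscale_sum
  by (subst sum.swap) (simp add: mult.commute)

lemma comult_eq_flip_cop: "comult C v = tlin (\<lambda>a b. b \<otimes>\<^sub>k a) (comult (cop C) v)"
proof -
  have "tlin (\<lambda>a b. b \<otimes>\<^sub>k a) (comult (cop C) v) = sw C v (\<otimes>\<^sub>k)"
    unfolding sw_def[symmetric] sw_cop ..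
  then show ?thesis by (simp add: sw_tens_id)
qed

context coalgebra
begin

lemma sw_counit_left: "vlinear L \<Longrightarrow> sw C v (\<lambda>v1 v2. vscale (counit C v1) (L v2)) = L v"
  using sw_comp[of L C v "\<lambda>v1 v2. vscale (counit C v1) v2"]
  by (simp add: counit_left vlinear_scale)

lemma sw_counit_right: "vlinear L \<Longrightarrow> sw C v (\<lambda>v1 v2. vscale (counit C v2) (L v1)) = L v"
  using sw_comp[of L C v "\<lambda>v1 v2. vscale (counit C v2) v1"]
  by (simp add: counit_right vlinear_scale)

lemma vlinear_comult_cop: "vlinear (comult (cop C))"
  using vlinear_sw by (simp add: cop_def)

text \<open>
  The maps \<open>id \<otimes> \<epsilon>\<close> and \<open>\<epsilon> \<otimes> id\<close>. Applied to the coalgebra morphism condition for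
  \<open>x \<otimes> y \<mapsto> y\<^sub>(\<^sub>1\<^sub>) : x\<^sub>(\<^sub>2\<^sub>) \<otimes> x\<^sub>(\<^sub>1\<^sub>) \<cdot> y\<^sub>(\<^sub>2\<^sub>)\<close> in three of the four possible combinations, they split it
  into the three identities \<open>comult_dot\<close>, \<open>comult_colon\<close> and \<open>exchange\<close> below.
\<close>

definition id_eps :: "('b \<times> 'b \<Rightarrow>\<^sub>0 'k) \<Rightarrow> ('b \<Rightarrow>\<^sub>0 'k)" where
  "id_eps = tlin (\<lambda>u v. vscale (counit C v) u)"

definition eps_id :: "('b \<times> 'b \<Rightarrow>\<^sub>0 'k) \<Rightarrow> ('b \<Rightarrow>\<^sub>0 'k)" where
  "eps_id = tlin (\<lambda>u v. vscale (counit C u) v)"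

lemma vlinear_id_eps: "vlinear id_eps" and vlinear_eps_id: "vlinear eps_id"
  by (simp_all add: id_eps_def eps_id_def vlinear_tlin)

lemma id_eps_tens: "id_eps (u \<otimes>\<^sub>k v) = vscale (counit C v) u"
  and eps_id_tens: "eps_id (u \<otimes>\<^sub>k v) = vscale (counit C u) v"
  by (simp_all add: id_eps_def eps_id_def tlin_tens vbilinear_counit
      vbilinear_flip[OF vbilinear_counit])

lemma id_eps_bvec: "id_eps (bvec (i, j)) = vscale (counit C (bvec j)) (bvec i)"
  and eps_id_bvec: "eps_id (bvec (i, j)) = vscale (counit C (bvec i)) (bvec j)"
  by (simp_all add: id_eps_def eps_id_def)

lemma vlinear_comult_tensor: "vlinear (comult (tensor_coalg K L))"
  by (simp add: tensor_coalg_def vlinear_tlin)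

lemma contract_eps_id_eps_id:
  "tlin (\<lambda>s t. eps_id s \<otimes>\<^sub>k eps_id t) (comult (tensor_coalg (cop C) C) t) = comult C (eps_id t)"
  (is "?f t = ?g t")
proof (rule tlin_eqI[of ?f ?g])
  fix i j
  let ?\<epsilon> = "counit C"
  have "tlin (\<lambda>s t. eps_id s \<otimes>\<^sub>k eps_id t) (comult (tensor_coalg (cop C) C) (bvec (i, j))) =
    sw C (bvec i) (\<lambda>u1 u2. sw C (bvec j) (\<lambda>v1 v2. vscale (?\<epsilon> u2) (vscale (?\<epsilon> u1) (v1 \<otimes>\<^sub>k v2))))"
    unfolding sw_def[of "tensor_coalg _ _", symmetric] sw_tensor_coalg_bvec sw_cop
    by (intro sw_cong) (simp add: eps_id_bvec tens_simps mult.commute)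
  also have "\<dots> = sw C (bvec i) (\<lambda>u1 u2. vscale (?\<epsilon> u2) (vscale (?\<epsilon> u1) (comult C (bvec j))))"
    by (simp only: sw_comp[OF vlinear_vscale, symmetric] sw_tens_id)
  also have "\<dots> = vscale (?\<epsilon> (bvec i)) (comult C (bvec j))"
    by (rule sw_counit_right[OF vlinear_counit])
  finally show "tlin (\<lambda>s t. eps_id s \<otimes>\<^sub>k eps_id t) (comult (tensor_coalg (cop C) C) (bvec (i, j)))
    = comult C (eps_id (bvec (i, j)))"
    by (simp add: eps_id_bvec vlinear_scale[OF linear_comult])
qed (intro vlinear_comp[OF vlinear_comult_tensor vlinear_tlin]
      vlinear_comp[OF vlinear_eps_id linear_comult])+

lemma contract_id_eps_id_eps:
  "tlin (\<lambda>s t. id_eps s \<otimes>\<^sub>k id_eps t) (comult (tensor_coalg (cop C) C) t)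
    = comult (cop C) (id_eps t)" (is "?f t = ?g t")
proof (rule tlin_eqI[of ?f ?g])
  fix i j
  let ?\<epsilon> = "counit C"
  have "tlin (\<lambda>s t. id_eps s \<otimes>\<^sub>k id_eps t) (comult (tensor_coalg (cop C) C) (bvec (i, j))) =
    sw C (bvec i) (\<lambda>u1 u2. sw C (bvec j) (\<lambda>v1 v2. vscale (?\<epsilon> v2) (vscale (?\<epsilon> v1) (u2 \<otimes>\<^sub>k u1))))"
    unfolding sw_def[of "tensor_coalg _ _", symmetric] sw_tensor_coalg_bvec sw_cop
    by (intro sw_cong) (simp add: id_eps_bvec tens_simps mult.commute)
  also have "\<dots> = sw C (bvec i) (\<lambda>u1 u2. vscale (?\<epsilon> (bvec j)) (u2 \<otimes>\<^sub>k u1))"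
    by (simp only: sw_counit_right[OF vlinear_counit])
  also have "\<dots> = vscale (?\<epsilon> (bvec j)) (comult (cop C) (bvec i))"
    by (simp add: sw_comp[OF vlinear_vscale, symmetric] cop_def)
  finally show "tlin (\<lambda>s t. id_eps s \<otimes>\<^sub>k id_eps t) (comult (tensor_coalg (cop C) C) (bvec (i, j)))
    = comult (cop C) (id_eps (bvec (i, j)))"
    by (simp add: id_eps_bvec vlinear_scale[OF vlinear_comult_cop])
qed (intro vlinear_comp[OF vlinear_comult_tensor vlinear_tlin]
      vlinear_comp[OF vlinear_id_eps vlinear_comult_cop])+

text \<open>
  The mixed contraction cancels one tensor factor on each side of the comultiplication of
  \<open>C\<^sup>c\<^sup>o\<^sup>p \<otimes> C\<close>, and so recovers the tensor that was comultiplied.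
\<close>

lemma contract_id_eps_eps_id:
  "tlin (\<lambda>s t. id_eps s \<otimes>\<^sub>k eps_id t) (comult (tensor_coalg (cop C) C) t) = t"
  (is "?f t = t")
proof (rule tlin_eqI[of ?f "\<lambda>t. t"])
  fix i j
  let ?\<epsilon> = "counit C"
  have "tlin (\<lambda>s t. id_eps s \<otimes>\<^sub>k eps_id t) (comult (tensor_coalg (cop C) C) (bvec (i, j))) =
    sw C (bvec i) (\<lambda>u1 u2. sw C (bvec j) (\<lambda>v1 v2. vscale (?\<epsilon> v1) (vscale (?\<epsilon> u1) (u2 \<otimes>\<^sub>k v2))))"
    unfolding sw_def[of "tensor_coalg _ _", symmetric] sw_tensor_coalg_bvec sw_cop
    by (intro sw_cong) (simp add: id_eps_bvec eps_id_bvec tens_simps mult.commute)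
  also have "\<dots> = sw C (bvec i) (\<lambda>u1 u2. vscale (?\<epsilon> u1) (u2 \<otimes>\<^sub>k bvec j))"
    by (subst sw_counit_left)
      (auto intro!: vlinear_comp[OF vbilinearD(2)[OF vbilinear_tens] vlinear_vscale])
  also have "\<dots> = bvec i \<otimes>\<^sub>k bvec j"
    by (rule sw_counit_left[OF vbilinearD(1)[OF vbilinear_tens]])
  finally show "tlin (\<lambda>s t. id_eps s \<otimes>\<^sub>k eps_id t) (comult (tensor_coalg (cop C) C) (bvec (i, j)))
    = bvec (i, j)"
    by simp
qed (intro vlinear_comp[OF vlinear_comult_tensor vlinear_tlin] vlinear_id)+

lemma vbilinear_sw_sw:
  "vbilinear (\<lambda>u v. sw C u (\<lambda>u1 u2. sw C v (\<lambda>v1 v2. B u1 u2 v1 v2)))"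
  by (intro vbilinearI vlinear_sw vlinear_sw_param)

end

context q_magma_coalgebra
begin

definition twist :: "('b \<times> 'b \<Rightarrow>\<^sub>0 'k) \<Rightarrow> ('b \<times> 'b \<Rightarrow>\<^sub>0 'k)" where
  "twist = tlin (\<lambda>x y. sw C x (\<lambda>x1 x2. sw C y (\<lambda>y1 y2. d (y1 \<otimes>\<^sub>k x2) \<otimes>\<^sub>k p (x1 \<otimes>\<^sub>k y2))))"

lemma vbilinear_dot: "vbilinear (\<lambda>u v. p (u \<otimes>\<^sub>k v))"
  and vbilinear_colon: "vbilinear (\<lambda>u v. d (u \<otimes>\<^sub>k v))"
  by (rule vbilinear_comp[OF vbilinear_tens linear_p] vbilinear_comp[OF vbilinear_tens linear_d])+

lemma vlinear_twist: "vlinear twist"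
  by (simp add: twist_def vlinear_tlin)

lemma eps_id_twist: "eps_id (twist (u \<otimes>\<^sub>k v)) = p (u \<otimes>\<^sub>k v)"
proof (rule tlin_eqI)
  fix i j
  have "eps_id (twist (bvec (i, j))) = sw C (bvec i) (\<lambda>x1 x2. sw C (bvec j) (\<lambda>y1 y2.
      vscale (counit C y1) (vscale (counit C x2) (p (x1 \<otimes>\<^sub>k y2)))))"
    by (simp add: twist_def sw_comp[OF vlinear_eps_id] eps_id_tens counit_d)
  also have "\<dots> = sw C (bvec i) (\<lambda>x1 x2. vscale (counit C x2) (p (x1 \<otimes>\<^sub>k bvec j)))"
    by (subst sw_counit_left)
      (auto intro!: vlinear_comp[OF vbilinearD(2)[OF vbilinear_dot] vlinear_vscale])
  also have "\<dots> = p (bvec i \<otimes>\<^sub>k bvec j)"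
    by (rule sw_counit_right[OF vbilinearD(1)[OF vbilinear_dot]])
  finally show "eps_id (twist (bvec (i, j))) = p (bvec (i, j))"
    by simp
qed (intro vlinear_comp[OF vlinear_twist vlinear_eps_id] linear_p)+

lemma id_eps_twist: "id_eps (twist (u \<otimes>\<^sub>k v)) = d (v \<otimes>\<^sub>k u)"
proof (rule vbilinear_eqI[of "\<lambda>u v. id_eps (twist (u \<otimes>\<^sub>k v))" "\<lambda>u v. d (v \<otimes>\<^sub>k u)"])
  fix i j
  have "id_eps (twist (bvec (i, j))) = sw C (bvec i) (\<lambda>x1 x2. sw C (bvec j) (\<lambda>y1 y2.
      vscale (counit C y2) (vscale (counit C x1) (d (y1 \<otimes>\<^sub>k x2)))))"
    by (simp add: twist_def sw_comp[OF vlinear_id_eps] id_eps_tens counit_p mult.commute)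
  also have "\<dots> = sw C (bvec i) (\<lambda>x1 x2. vscale (counit C x1) (d (bvec j \<otimes>\<^sub>k x2)))"
    by (subst sw_counit_right)
      (auto intro!: vlinear_comp[OF vbilinearD(1)[OF vbilinear_colon] vlinear_vscale])
  also have "\<dots> = d (bvec j \<otimes>\<^sub>k bvec i)"
    by (rule sw_counit_left[OF vbilinearD(2)[OF vbilinear_colon]])
  finally show "id_eps (twist (bvec i \<otimes>\<^sub>k bvec j)) = d (bvec j \<otimes>\<^sub>k bvec i)"
    by simp
qed (intro vbilinear_comp[OF vbilinear_tens] vlinear_comp[OF vlinear_twist vlinear_id_eps]
    vbilinear_flip[OF vbilinear_colon])+

lemma comult_twist:
  "tlin (\<lambda>s t. E s \<otimes>\<^sub>k E' t) (comult (tensor_coalg (cop C) C) (twist (bvec i \<otimes>\<^sub>k bvec j))) =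
    sw C (bvec i) (\<lambda>x1 x2. sw C (bvec j) (\<lambda>y1 y2.
      E (twist (x1 \<otimes>\<^sub>k y2)) \<otimes>\<^sub>k E' (twist (x2 \<otimes>\<^sub>k y1))))"
  if "vlinear E" "vlinear E'"
proof -
  have "comult (tensor_coalg (cop C) C) (twist (bvec (i, j))) =
      sw (tensor_coalg C (cop C)) (bvec (i, j)) (\<lambda>s t. twist s \<otimes>\<^sub>k twist t)"
    using q_magma unfolding coalgebra_morphism_def twist_def[symmetric] by blast
  then show ?thesis
    using that
    by (simp add: sw_tensor_coalg_bvec sw_cop sw_comp[OF vlinear_tlin] tlin_tens
        vbilinear_comp2[OF vbilinear_tens])
qed

lemma comult_dot: "comult C (p (u \<otimes>\<^sub>k v)) =
    sw C u (\<lambda>u1 u2. sw C v (\<lambda>v1 v2. p (u1 \<otimes>\<^sub>k v2) \<otimes>\<^sub>k p (u2 \<otimes>\<^sub>k v1)))"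
  by (rule vbilinear_eqI[of "\<lambda>u v. comult C (p (u \<otimes>\<^sub>k v))",
        OF vbilinear_comp[OF vbilinear_dot linear_comult] vbilinear_sw_sw])
    (use comult_twist[OF vlinear_eps_id vlinear_eps_id] in
      \<open>simp only: contract_eps_id_eps_id eps_id_twist\<close>)

lemma comult_colon: "comult C (d (v \<otimes>\<^sub>k u)) =
    sw C v (\<lambda>v1 v2. sw C u (\<lambda>u1 u2. d (v1 \<otimes>\<^sub>k u2) \<otimes>\<^sub>k d (v2 \<otimes>\<^sub>k u1)))"
proof (rule vbilinear_eqI[of "\<lambda>u v. comult C (d (v \<otimes>\<^sub>k u))"])
  fix i j
  have "comult (cop C) (d (bvec j \<otimes>\<^sub>k bvec i)) = sw C (bvec i) (\<lambda>u1 u2. sw C (bvec j) (\<lambda>v1 v2.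
      d (v2 \<otimes>\<^sub>k u1) \<otimes>\<^sub>k d (v1 \<otimes>\<^sub>k u2)))"
    using comult_twist[OF vlinear_id_eps vlinear_id_eps, of i j]
    by (simp only: contract_id_eps_id_eps id_eps_twist)
  then show "comult C (d (bvec j \<otimes>\<^sub>k bvec i)) = sw C (bvec j) (\<lambda>v1 v2. sw C (bvec i) (\<lambda>u1 u2.
      d (v1 \<otimes>\<^sub>k u2) \<otimes>\<^sub>k d (v2 \<otimes>\<^sub>k u1)))"
    by (subst comult_eq_flip_cop)
      (simp add: sw_comp[OF vlinear_tlin] tlin_tens vbilinear_flip[OF vbilinear_tens]
        sw_swap[of C "bvec i"])
qed (rule vbilinear_comp[OF vbilinear_flip[OF vbilinear_colon] linear_comult]
    vbilinear_flip[OF vbilinear_sw_sw])+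

text \<open>
  The two components of a coalgebra morphism into a tensor product commute with each other in the
  sense of Sweedler. This is the only part of the q-magma condition that relates the two operations;
  evaluated at \<open>g \<otimes> x\<close> with \<open>g\<close> group-like it yields \<open>g \<cdot> x = 0\<close> and \<open>g \<cdot> a = g\<close>
  (\<open>dt_group_x_and_elt\<close>).
\<close>

lemma exchange: "sw C u (\<lambda>u1 u2. sw C v (\<lambda>v1 v2. d (v1 \<otimes>\<^sub>k u2) \<otimes>\<^sub>k p (u1 \<otimes>\<^sub>k v2))) =
    sw C u (\<lambda>u1 u2. sw C v (\<lambda>v1 v2. d (v2 \<otimes>\<^sub>k u1) \<otimes>\<^sub>k p (u2 \<otimes>\<^sub>k v1)))"
proof (rule vbilinear_eqI[OF vbilinear_sw_sw vbilinear_sw_sw])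
  fix i j
  show "sw C (bvec i) (\<lambda>u1 u2. sw C (bvec j) (\<lambda>v1 v2. d (v1 \<otimes>\<^sub>k u2) \<otimes>\<^sub>k p (u1 \<otimes>\<^sub>k v2))) =
    sw C (bvec i) (\<lambda>u1 u2. sw C (bvec j) (\<lambda>v1 v2. d (v2 \<otimes>\<^sub>k u1) \<otimes>\<^sub>k p (u2 \<otimes>\<^sub>k v1)))"
    using comult_twist[OF vlinear_id_eps vlinear_eps_id, of i j]
    by (simp only: contract_id_eps_eps_id id_eps_twist eps_id_twist) (simp add: twist_def)
qed

end

section \<open>The regular representation of a rank one Hopf algebra\<close>

lemma keys_lin_ext: "Poly_Mapping.keys (lin_ext f v) \<subseteq> (\<Union>b\<in>Poly_Mapping.keys v. Poly_Mapping.keys (f b))"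
  by (auto simp: in_keys_iff lin_ext_def lookup_sum elim!: sum.not_neutral_contains_not_neutral)
    (metis in_keys_iff mult_zero_right)

lemma keys_vscale: "Poly_Mapping.keys (vscale c v) \<subseteq> Poly_Mapping.keys v"
  by (auto simp: in_keys_iff)

lemma supported_closed:
  "Poly_Mapping.keys (0 :: 'b \<Rightarrow>\<^sub>0 'k) \<subseteq> A"
  "b \<in> A \<Longrightarrow> Poly_Mapping.keys (bvec b :: 'b \<Rightarrow>\<^sub>0 'k) \<subseteq> A"
  "Poly_Mapping.keys u \<subseteq> A \<Longrightarrow> Poly_Mapping.keys v \<subseteq> A \<Longrightarrow> Poly_Mapping.keys (u + v) \<subseteq> A"
  "Poly_Mapping.keys u \<subseteq> A \<Longrightarrow> Poly_Mapping.keys v \<subseteq> A \<Longrightarrow> Poly_Mapping.keys (u - v) \<subseteq> A"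
  "Poly_Mapping.keys v \<subseteq> A \<Longrightarrow> Poly_Mapping.keys (vscale c v) \<subseteq> A"
  for u v :: "'b \<Rightarrow>\<^sub>0 'k::field"
  using Poly_Mapping.keys_add[of u v] keys_diff[of u v] keys_vscale[of c v] by auto

text \<open>
  The basis vector \<open>(g, m)\<close> stands for \<open>g x\<^sup>m\<close>, and the generators act in the way left
  multiplication in the rank one Hopf algebra has to: \<open>x g x\<^sup>m = \<chi>(g) g x\<^sup>m\<^sup>+\<^sup>1\<close>, where \<open>x\<^sup>n\<close> is rewritten to
  \<open>\<alpha> (a\<^sup>n - 1)\<close>. This module is what shows that the relations do not collapse the monomials
  \<open>g x\<^sup>m\<close>, \<open>m < n\<close>.
\<close>

definition model_act ::
  "('g, 'k::field) rank_one_data \<Rightarrow> 'g generator \<Rightarrow> ('g \<times> nat \<Rightarrow>\<^sub>0 'k) \<Rightarrow> ('g \<times> nat \<Rightarrow>\<^sub>0 'k)" where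
  "model_act D s = lin_ext (\<lambda>(g, m). case s of
     Gen h \<Rightarrow> bvec (h \<otimes>\<^bsub>Grp D\<^esub> g, m)
   | X \<Rightarrow> vscale (Chi D g) (if Suc m < chi_order D then bvec (g, Suc m)
       else vscale (Alpha D)
         (bvec (g \<otimes>\<^bsub>Grp D\<^esub> Elt D [^]\<^bsub>Grp D\<^esub> chi_order D, 0) - bvec (g, 0))))"

definition model_rep ::
  "('g, 'k::field) rank_one_data \<Rightarrow> ('g generator list \<Rightarrow>\<^sub>0 'k) \<Rightarrow>
    ('g \<times> nat \<Rightarrow>\<^sub>0 'k) \<Rightarrow> ('g \<times> nat \<Rightarrow>\<^sub>0 'k)" where
  "model_rep D u v = lin_ext (\<lambda>w. foldr (model_act D) w v) u"

definition model_space :: "('g, 'k::field) rank_one_data \<Rightarrow> ('g \<times> nat \<Rightarrow>\<^sub>0 'k) set" where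
  "model_space D = {v. Poly_Mapping.keys v \<subseteq> carrier (Grp D) \<times> {..<chi_order D}}"

lemma vlinear_foldr:
  assumes "\<And>s. vlinear (f s)"
  shows "vlinear (\<lambda>v. foldr f w v)"
proof (induction w)
  case (Cons s w)
  show ?case using vlinear_comp[OF Cons.IH assms[of s]] by simp
qed (simp add: vlinear_id)

lemma vlinear_model_act: "vlinear (model_act D s)"
  by (simp add: model_act_def vlinear_lin_ext)

lemma vbilinear_model_rep: "vbilinear (model_rep D)"
  unfolding model_rep_def
  by (intro vbilinearI vlinear_lin_ext vlinear_lin_ext_param vlinear_foldr vlinear_model_act)

lemma model_rep_bvec: "model_rep D (bvec w) v = foldr (model_act D) w v"
  by (simp add: model_rep_def)

lemma vbilinear_word_mult: "vbilinear word_mult"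
  unfolding word_mult_def by (intro vbilinear_comp[OF vbilinear_tens] vlinear_lin_ext)

lemma model_rep_word_mult: "model_rep D (word_mult u u') v = model_rep D u (model_rep D u' v)"
proof (rule vbilinear_eqI[of "\<lambda>u u'. model_rep D (word_mult u u') v"])
  show "vbilinear (\<lambda>u u'. model_rep D (word_mult u u') v)"
    by (rule vbilinear_comp[OF vbilinear_word_mult vbilinearD(1)[OF vbilinear_model_rep]])
  show "vbilinear (\<lambda>u u'. model_rep D u (model_rep D u' v))"
    by (rule vbilinear_comp2[OF vbilinear_model_rep vlinear_id
          vbilinearD(1)[OF vbilinear_model_rep]])
  show "model_rep D (word_mult (bvec w) (bvec w')) v
      = model_rep D (bvec w) (model_rep D (bvec w') v)" for w w'
    by (simp add: word_mult_def model_rep_bvec)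
qed

lemma keys_lin_ext_subset:
  assumes "Poly_Mapping.keys v \<subseteq> B" "\<And>b. b \<in> B \<Longrightarrow> Poly_Mapping.keys (f b) \<subseteq> A"
  shows "Poly_Mapping.keys (lin_ext f v) \<subseteq> A"
  using keys_lin_ext[of f v] assms by blast

lemma word_mult_word_alg:
  assumes "u \<in> word_alg S" "v \<in> word_alg S"
  shows "word_mult u v \<in> word_alg S"
proof -
  have "Poly_Mapping.keys (u \<otimes>\<^sub>k v) \<subseteq> lists S \<times> lists S"
    using assms by (auto simp: in_keys_iff word_alg_def)
  then show ?thesis
    unfolding word_mult_def word_alg_def mem_Collect_eq
    by (rule keys_lin_ext_subset) auto
qed

lemma subspace_iff:
  fixes S :: "('b \<Rightarrow>\<^sub>0 'k::field) set"
  shows "module.subspace vscale S \<longleftrightarrow>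
    0 \<in> S \<and> (\<forall>u\<in>S. \<forall>v\<in>S. u + v \<in> S) \<and> (\<forall>c. \<forall>v\<in>S. vscale c v \<in> S)"
proof -
  interpret vector_space "vscale :: 'k \<Rightarrow> ('b \<Rightarrow>\<^sub>0 'k) \<Rightarrow> _" by (rule vector_space_vscale)
  show ?thesis by (simp add: subspace_def)
qed

context rank_one_datum
begin

interpretation G: group "Grp D" by (rule group)

abbreviation n :: nat where "n \<equiv> chi_order D"

abbreviation chi where "chi \<equiv> Chi D"

abbreviation a where "a \<equiv> Elt D"

abbreviation q where "q \<equiv> chi a"

lemma chi_mult: "g \<in> carrier (Grp D) \<Longrightarrow> h \<in> carrier (Grp D) \<Longrightarrow> chi (g \<otimes>\<^bsub>Grp D\<^esub> h) = chi g * chi h"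
  using character by (auto simp: hom_def field_units_def)

lemma chi_nz: "g \<in> carrier (Grp D) \<Longrightarrow> chi g \<noteq> 0"
  using character by (auto simp: hom_def field_units_def)

lemma chi_one: "chi \<one>\<^bsub>Grp D\<^esub> = 1"
  using chi_mult[of "\<one>\<^bsub>Grp D\<^esub>" "\<one>\<^bsub>Grp D\<^esub>"] chi_nz[of "\<one>\<^bsub>Grp D\<^esub>"] by simp

lemma chi_pow: "g \<in> carrier (Grp D) \<Longrightarrow> chi (g [^]\<^bsub>Grp D\<^esub> (k::nat)) = chi g ^ k"
  by (induction k) (auto simp: chi_one chi_mult)

lemma field_units_pow: "c [^]\<^bsub>(field_units :: 'k monoid)\<^esub> (k::nat) = c ^ k"
  by (induction k) (auto simp: field_units_def nat_pow_def mult.commute)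

lemma q_pow_eq_1_iff: "q ^ k = 1 \<longleftrightarrow> n dvd k"
proof -
  interpret U: group "field_units :: 'k monoid" by (rule group_field_units)
  have "q \<in> carrier field_units" using chi_nz[OF elt] by (simp add: field_units_def)
  from U.pow_eq_id[OF this, of k] show ?thesis
    by (simp add: field_units_pow chi_order_def) (simp add: field_units_def)
qed

lemma n_gt_1: "n > 1" by (rule order_gt_1)

lemma central_pow: "g \<in> carrier (Grp D) \<Longrightarrow>
    a [^]\<^bsub>Grp D\<^esub> (k::nat) \<otimes>\<^bsub>Grp D\<^esub> g = g \<otimes>\<^bsub>Grp D\<^esub> a [^]\<^bsub>Grp D\<^esub> k"
proof (induction k)
  case (Suc k)
  then show ?case using elt by (metis G.m_assoc G.nat_pow_Suc G.nat_pow_closed central)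
qed simp

lemma model_act_Gen [simp]: "model_act D (Gen h) (bvec (g, m)) = bvec (h \<otimes>\<^bsub>Grp D\<^esub> g, m)"
  by (simp add: model_act_def)

lemma model_act_X: "Suc m < n \<Longrightarrow> model_act D X (bvec (g, m)) = vscale (chi g) (bvec (g, Suc m))"
  and model_act_X_wrap: "\<not> Suc m < n \<Longrightarrow> model_act D X (bvec (g, m)) = vscale (chi g * Alpha D)
      (bvec (g \<otimes>\<^bsub>Grp D\<^esub> a [^]\<^bsub>Grp D\<^esub> n, 0) - bvec (g, 0))"
  by (simp_all add: model_act_def)

lemma bvec_model_space: "g \<in> carrier (Grp D) \<Longrightarrow> m < n \<Longrightarrow> bvec (g, m) \<in> model_space D"
  by (simp add: model_space_def)

lemma model_space_closed:
  "0 \<in> model_space D"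
  "u \<in> model_space D \<Longrightarrow> v \<in> model_space D \<Longrightarrow> u + v \<in> model_space D"
  "u \<in> model_space D \<Longrightarrow> v \<in> model_space D \<Longrightarrow> u - v \<in> model_space D"
  "v \<in> model_space D \<Longrightarrow> vscale c v \<in> model_space D"
  unfolding model_space_def mem_Collect_eq by (fact supported_closed)+

lemma model_act_closed:
  assumes "s \<in> generators (Grp D)" "v \<in> model_space D"
  shows "model_act D s v \<in> model_space D"
proof -
  have "model_act D s (bvec (g, m)) \<in> model_space D" if "g \<in> carrier (Grp D)" "m < n" for g m
  proof (cases s)
    case X
    then show ?thesis using that n_gt_1 elt
      by (cases "Suc m < n")
        (auto simp: model_act_X model_act_X_wrap intro!: model_space_closed bvec_model_space)
  qed (use that assms(1) in \<open>auto simp: generators_def intro!: bvec_model_space\<close>)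
  then have "Poly_Mapping.keys (lin_ext (\<lambda>b. model_act D s (bvec b)) v) \<subseteq> carrier (Grp D) \<times> {..<n}"
    by (intro keys_lin_ext_subset[OF assms(2)[unfolded model_space_def mem_Collect_eq]])
      (auto simp: model_space_def)
  moreover have "model_act D s v = lin_ext (\<lambda>b. model_act D s (bvec b)) v"
    using vlinear_lin_ext_comp[OF vlinear_model_act, of D s bvec v] by (simp add: lin_ext_bvec_id)
  ultimately show ?thesis
    by (simp add: model_space_def)
qed

lemma model_rep_closed:
  assumes "u \<in> word_alg (generators (Grp D))" "v \<in> model_space D"
  shows "model_rep D u v \<in> model_space D"
proof -
  have "foldr (model_act D) w v \<in> model_space D" if "w \<in> lists (generators (Grp D))" for w
    using that by (induction w) (auto simp: assms(2) intro!: model_act_closed)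
  then show ?thesis
    using assms(1) unfolding model_rep_def model_space_def word_alg_def mem_Collect_eq
    by (rule keys_lin_ext_subset[rotated])
qed

lemma model_X_pow:
  "m + k < n \<Longrightarrow> (model_act D X ^^ k) (bvec (g, m))
    = vscale (chi g ^ k) (bvec (g, m + k))"
proof (induction k)
  case (Suc k)
  then show ?case
    by (simp add: vlinear_scale[OF vlinear_model_act] model_act_X mult.commute)
qed simp

lemma model_Gen_pow:
  assumes "h \<in> carrier (Grp D)" "g \<in> carrier (Grp D)"
  shows "(model_act D (Gen h) ^^ k) (bvec (g, m))
    = bvec (h [^]\<^bsub>Grp D\<^esub> k \<otimes>\<^bsub>Grp D\<^esub> g, m)"
proof (induction k)
  case (Suc k)
  then show ?case using assms by (simp add: G.m_assoc[symmetric] flip: G.nat_pow_Suc2)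
qed (simp add: assms)

text \<open>
  Applying \<open>x\<close> \<open>n\<close> times to \<open>g x\<^sup>m\<close> wraps around once and gives the scalar \<open>\<chi>(g)\<^sup>n\<close> in
  front of \<open>\<alpha> (a\<^sup>n - 1) g x\<^sup>m\<close>. The alternative in the definition of a datum says exactly that this
  scalar is 1 or that the element it multiplies is 0.
\<close>

lemma model_X_order:
  assumes g: "g \<in> carrier (Grp D)" and m: "m < n"
  shows "(model_act D X ^^ n) (bvec (g, m)) =
    vscale (Alpha D) (bvec (a [^]\<^bsub>Grp D\<^esub> n \<otimes>\<^bsub>Grp D\<^esub> g, m) - bvec (g, m))"
proof -
  let ?e = "a [^]\<^bsub>Grp D\<^esub> n"
  let ?f = "\<lambda>k v. (model_act D X ^^ k) v"
  have lin: "vlinear (?f k)" for k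
    using vlinear_foldr[of "model_act D" "replicate k X", OF vlinear_model_act] by simp
  obtain k where k: "n = Suc (m + k)" using m less_imp_Suc_add by blast
  have "chi ?e = 1"
    by (simp add: chi_pow elt q_pow_eq_1_iff)
  then have chi_ge: "chi (g \<otimes>\<^bsub>Grp D\<^esub> ?e) = chi g"
    using g elt by (simp add: chi_mult)
  have "?f n (bvec (g, m)) = ?f m (model_act D X (?f k (bvec (g, m))))"
    unfolding k by (metis add_Suc_right comp_apply funpow.simps(2) funpow_add)
  also have "\<dots> = ?f m (vscale (chi g ^ Suc k * Alpha D)
      (bvec (g \<otimes>\<^bsub>Grp D\<^esub> ?e, 0) - bvec (g, 0)))"
    using k by (simp add: model_X_pow vlinear_scale[OF vlinear_model_act] model_act_X_wrap algebra_simps)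
  also have "\<dots> = vscale (chi g ^ Suc k * Alpha D * chi g ^ m)
      (bvec (g \<otimes>\<^bsub>Grp D\<^esub> ?e, m) - bvec (g, m))"
    using m by (simp add: vlinear_scale[OF lin] vlinear_diff[OF lin] model_X_pow chi_ge vscale_diff)
  also have "chi g ^ Suc k * Alpha D * chi g ^ m = chi g ^ n * Alpha D"
    by (simp add: k power_add algebra_simps)
  also have "vscale (chi g ^ n * Alpha D) (bvec (g \<otimes>\<^bsub>Grp D\<^esub> ?e, m) - bvec (g, m)) =
      vscale (Alpha D) (bvec (?e \<otimes>\<^bsub>Grp D\<^esub> g, m) - bvec (g, m))"
  proof (cases "Alpha D = 0 \<or> ?e = \<one>\<^bsub>Grp D\<^esub>")
    case False
    then have "Poly_Mapping.lookup (bvec ?e - bvec \<one>\<^bsub>Grp D\<^esub> :: 'g \<Rightarrow>\<^sub>0 'k) ?e = 1"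
      by (auto simp: lookup_minus lookup_single)
    then have "(bvec ?e - bvec \<one>\<^bsub>Grp D\<^esub> :: 'g \<Rightarrow>\<^sub>0 'k) \<noteq> 0"
      by auto
    with False compatible have "chi g ^ n = 1"
      using g by (auto simp: vscale_eq_0_iff)
    then show ?thesis by (simp add: central_pow g)
  qed (use g in auto)
  finally show ?thesis .
qed

lemma model_rep_relation:
  assumes "r \<in> relations D" "v \<in> model_space D"
  shows "model_rep D r v = 0"
proof -
  have *: "model_rep D r (bvec (g, m)) = 0" if g: "g \<in> carrier (Grp D)" and m: "m < n" for g m
  proof -
    note lin = vbilinear_simps[OF vbilinear_model_rep]
    consider (mult) h h' where "h \<in> carrier (Grp D)" "h' \<in> carrier (Grp D)"
        "r = bvec [Gen h, Gen h'] - bvec [Gen (h \<otimes>\<^bsub>Grp D\<^esub> h')]"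
      | (one) "r = bvec [Gen \<one>\<^bsub>Grp D\<^esub>] - bvec []"
      | (pow) "r = bvec (replicate n X) -
          vscale (Alpha D) (bvec (replicate n (Gen a)) - bvec [])"
      | (comm) h where "h \<in> carrier (Grp D)" "r = bvec [X, Gen h] - vscale (chi h) (bvec [Gen h, X])"
      using assms(1) unfolding relations_def by blast
    then show ?thesis
    proof cases
      case mult
      then show ?thesis using g by (simp add: lin model_rep_bvec G.m_assoc)
    next
      case one
      then show ?thesis using g by (simp add: lin model_rep_bvec)
    next
      case pow
      then show ?thesis using g m elt
        by (simp add: lin model_rep_bvec model_X_order model_Gen_pow)
    next
      case comm
      then show ?thesis using g m elt
        by (cases "Suc m < n")
          (auto simp: lin model_rep_bvec model_act_X model_act_X_wrap chi_mult G.m_assoc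
            vlinear_scale[OF vlinear_model_act] vlinear_diff[OF vlinear_model_act] ac_simps)
    qed
  qed
  have "model_rep D r v = lin_ext (\<lambda>b. model_rep D r (bvec b)) v"
    using vlinear_lin_ext_comp[OF vbilinearD(2)[OF vbilinear_model_rep], of D r bvec v]
    by (simp add: lin_ext_bvec_id)
  also have "\<dots> = lin_ext (\<lambda>b. 0) v"
    by (rule lin_ext_cong) (use * assms(2) in \<open>auto simp: model_space_def\<close>)
  finally show ?thesis by (simp add: lin_ext_def)
qed

lemma word_alg_closed:
  "w \<in> lists S \<Longrightarrow> bvec w \<in> word_alg S"
  "u \<in> word_alg S \<Longrightarrow> v \<in> word_alg S \<Longrightarrow> u + v \<in> word_alg S"
  "u \<in> word_alg S \<Longrightarrow> v \<in> word_alg S \<Longrightarrow> u - v \<in> word_alg S"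
  "v \<in> word_alg S \<Longrightarrow> vscale c v \<in> word_alg S"
  "0 \<in> word_alg S"
  unfolding word_alg_def mem_Collect_eq by (fact supported_closed)+

lemma relations_word_alg: "relations D \<subseteq> word_alg (generators (Grp D))"
  unfolding relations_def
  by (auto intro!: word_alg_closed simp: generators_def in_lists_conv_set elt split: if_splits)

text \<open>
  The elements of the free algebra that annihilate the module form an ideal, and this ideal contains
  the relations.
\<close>

lemma model_rep_ideal:
  assumes "u \<in> ideal_generated (generators (Grp D)) (relations D)" "v \<in> model_space D"
  shows "model_rep D u v = 0"
proof -
  let ?S = "generators (Grp D)"
  let ?K = "{u \<in> word_alg ?S. \<forall>v\<in>model_space D. model_rep D u v = 0}"
  note lin = vbilinear_simps[OF vbilinear_model_rep]
  have "module.subspace vscale ?K"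
    by (auto simp: subspace_iff lin intro: word_alg_closed)
  then have "word_ideal ?S ?K"
    by (auto simp: word_ideal_def model_rep_word_mult model_rep_closed
        word_mult_word_alg vbilinear_simps[OF vbilinear_model_rep])
  moreover have "relations D \<subseteq> ?K"
    using relations_word_alg model_rep_relation by auto
  ultimately show ?thesis
    using assms unfolding ideal_generated_def by blast
qed

end

section \<open>Coordinates\<close>

context hopf_algebra
begin

lemma vbilinear_mult: "vbilinear (\<lambda>u v. u \<star> v)"
  by (intro vbilinearI mult_linear_left mult_linear_right)

lemmas mult_simps = vbilinear_simps[OF vbilinear_mult]

end

context rank_one_hopf_algebra
begin

interpretation G: group "Grp D" by (rule group)

abbreviation S where "S \<equiv> generators (Grp D)"

abbreviation e where "e \<equiv> case_generator \<iota> x"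

lemma vlinear_word_eval: "vlinear (word_eval H e)"
  by (simp add: word_eval_def vlinear_lin_ext)

lemma word_eval_bvec: "word_eval H e (bvec w) = foldr (\<lambda>s v. e s \<star> v) w \<eta>"
  by (simp add: word_eval_def)

lemma ex_word: "\<exists>u \<in> word_alg S. word_eval H e u = y"
proof -
  have "y \<in> word_eval H e ` word_alg S"
    using presentation unfolding presented_by_def by simp
  then show ?thesis by blast
qed

lemma kernel: "{u \<in> word_alg S. word_eval H e u = 0} = ideal_generated S (relations D)"
  using presentation unfolding presented_by_def by blast

lemma word_eval_relation: "r \<in> relations D \<Longrightarrow> word_eval H e r = 0"
  using kernel by (auto simp: ideal_generated_def)

definition xpow :: "nat \<Rightarrow> ('b \<Rightarrow>\<^sub>0 'k)" where "xpow m = (((\<star>) x) ^^ m) \<eta>"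

lemma xpow_0: "xpow 0 = \<eta>" and xpow_Suc: "xpow (Suc m) = x \<star> xpow m"
  by (simp_all add: xpow_def)

lemma xpow_Suc_right: "xpow (Suc m) = xpow m \<star> x"
proof (induction m)
  case (Suc m)
  then show ?case by (metis xpow_Suc mult_assoc)
qed (simp add: xpow_0 xpow_Suc one_left one_right)

lemma group_mult: 
  assumes "g \<in> carrier (Grp D)" "h \<in> carrier (Grp D)"
  shows "\<iota> g \<star> \<iota> h = \<iota> (g \<otimes>\<^bsub>Grp D\<^esub> h)"
proof -
  have "bvec [Gen g, Gen h] - bvec [Gen (g \<otimes>\<^bsub>Grp D\<^esub> h)] \<in> relations D"
    using assms unfolding relations_def by blast
  from word_eval_relation[OF this] show ?thesis
    by (simp add: vlinear_diff[OF vlinear_word_eval] word_eval_bvec one_right)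
qed

lemma group_one: "\<iota> \<one>\<^bsub>Grp D\<^esub> = \<eta>"
proof -
  have "bvec [Gen \<one>\<^bsub>Grp D\<^esub>] - bvec [] \<in> relations D"
    unfolding relations_def by blast
  from word_eval_relation[OF this] show ?thesis
    by (simp add: vlinear_diff[OF vlinear_word_eval] word_eval_bvec one_right)
qed

lemma group_pow:
  assumes "g \<in> carrier (Grp D)"
  shows "(((\<star>) (\<iota> g)) ^^ k) \<eta> = \<iota> (g [^]\<^bsub>Grp D\<^esub> k)"
proof (induction k)
  case (Suc k)
  then show ?case using assms by (simp add: group_mult flip: G.nat_pow_Suc2)
qed (simp add: group_one)

lemma x_order: "xpow n = vscale (Alpha D) (\<iota> (a [^]\<^bsub>Grp D\<^esub> n) - \<eta>)"
proof -
  have "bvec (replicate n X) - vscale (Alpha D) (bvec (replicate n (Gen a)) - bvec []) \<in> relations D"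
    unfolding relations_def by blast
  from word_eval_relation[OF this] show ?thesis
    by (simp add: vlinear_diff[OF vlinear_word_eval] vlinear_scale[OF vlinear_word_eval]
        word_eval_bvec xpow_def group_pow elt)
qed

lemma x_comm:
  assumes "g \<in> carrier (Grp D)"
  shows "x \<star> \<iota> g = vscale (chi g) (\<iota> g \<star> x)"
proof -
  have "bvec [X, Gen g] - vscale (chi g) (bvec [Gen g, X]) \<in> relations D"
    using assms unfolding relations_def by blast
  from word_eval_relation[OF this] show ?thesis
    by (simp add: vlinear_diff[OF vlinear_word_eval] vlinear_scale[OF vlinear_word_eval]
        word_eval_bvec one_right)
qed

definition gx :: "'g \<Rightarrow> nat \<Rightarrow> ('b \<Rightarrow>\<^sub>0 'k)" where "gx g m = \<iota> g \<star> xpow m"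

lemma gx_group: "gx g 0 = \<iota> g"
  by (simp add: gx_def xpow_0 one_right)

lemma gx_x: "gx \<one>\<^bsub>Grp D\<^esub> (Suc 0) = x"
  by (simp add: gx_def xpow_0 xpow_Suc one_right one_left group_one)

lemma group_gx:
  "g \<in> carrier (Grp D) \<Longrightarrow> h \<in> carrier (Grp D) \<Longrightarrow> \<iota> h \<star> gx g m = gx (h \<otimes>\<^bsub>Grp D\<^esub> g) m"
  by (simp add: gx_def group_mult flip: mult_assoc)

lemma gx_mult_x: "gx g m \<star> x = gx g (Suc m)"
  by (simp add: gx_def xpow_Suc_right mult_assoc)

lemma x_gx: "g \<in> carrier (Grp D) \<Longrightarrow> x \<star> gx g m = vscale (chi g) (gx g (Suc m))"
  by (simp add: gx_def xpow_Suc x_comm mult_simps flip: mult_assoc)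

lemma xpow_group:
  assumes "g \<in> carrier (Grp D)"
  shows "xpow m \<star> \<iota> g = vscale (chi g ^ m) (\<iota> g \<star> xpow m)"
proof (induction m)
  case (Suc m)
  have "xpow (Suc m) \<star> \<iota> g = x \<star> (xpow m \<star> \<iota> g)" by (simp add: xpow_Suc mult_assoc)
  also have "\<dots> = vscale (chi g ^ m) ((x \<star> \<iota> g) \<star> xpow m)"
    by (simp add: Suc mult_simps mult_assoc)
  finally show ?case
    by (simp add: x_comm assms mult_simps xpow_Suc mult_assoc mult.commute)
qed (simp add: xpow_0 one_left one_right)

lemma gx_group_right:
  "g \<in> carrier (Grp D) \<Longrightarrow> h \<in> carrier (Grp D) \<Longrightarrow>
    gx g m \<star> \<iota> h = vscale (chi h ^ m) (gx (g \<otimes>\<^bsub>Grp D\<^esub> h) m)"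
  by (simp add: gx_def mult_assoc xpow_group mult_simps) (simp add: group_mult flip: mult_assoc)

text \<open>
  The map \<open>(g, m) \<mapsto> g x\<^sup>m\<close> from the module to \<open>H\<close>; it intertwines the actions of the
  generators. With \<open>coords\<close>, the action on the vector that represents 1, it will form a pair of inverse
  linear maps.
\<close>

definition of_coords :: "('g \<times> nat \<Rightarrow>\<^sub>0 'k) \<Rightarrow> ('b \<Rightarrow>\<^sub>0 'k)" where
  "of_coords = lin_ext (\<lambda>(g, m). gx g m)"

lemma vlinear_of_coords: "vlinear of_coords"
  by (simp add: of_coords_def vlinear_lin_ext)

lemma of_coords_bvec: "of_coords (bvec (g, m)) = gx g m"
  by (simp add: of_coords_def)

lemma of_coords_act:
  assumes "s \<in> S" "v \<in> model_space D"
  shows "of_coords (model_act D s v) = e s \<star> of_coords v"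
proof -
  have *: "of_coords (model_act D s (bvec (g, m))) = e s \<star> gx g m"
    if g: "g \<in> carrier (Grp D)" and m: "m < n" for g m
  proof (cases s)
    case (Gen h)
    then show ?thesis using g assms(1)
      by (simp add: of_coords_bvec group_gx generators_def image_iff)
  next
    case X
    show ?thesis
    proof (cases "Suc m < n")
      case False
      then have "Suc m = n" using m by simp
      then have "gx g (Suc m) = vscale (Alpha D)
          (gx (g \<otimes>\<^bsub>Grp D\<^esub> a [^]\<^bsub>Grp D\<^esub> n) 0 - gx g 0)"
        using g elt
        by (simp add: gx_def x_order xpow_0 mult_simps one_right group_mult)
      then show ?thesis using X False g
        by (simp add: model_act_X_wrap vlinear_scale[OF vlinear_of_coords]
            vlinear_diff[OF vlinear_of_coords] of_coords_bvec x_gx)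
    qed (use X g in \<open>simp add: model_act_X vlinear_scale[OF vlinear_of_coords] of_coords_bvec x_gx\<close>)
  qed
  have "of_coords (model_act D s v) = lin_ext (\<lambda>b. of_coords (model_act D s (bvec b))) v"
    using vlinear_lin_ext_comp[OF vlinear_comp[OF vlinear_model_act vlinear_of_coords],
        of D s bvec v] by (simp add: lin_ext_bvec_id)
  also have "\<dots> = lin_ext (\<lambda>b. e s \<star> of_coords (bvec b)) v"
    by (rule lin_ext_cong) (use * assms(2) in \<open>auto simp: model_space_def of_coords_bvec\<close>)
  also have "\<dots> = e s \<star> of_coords v"
    using vlinear_lin_ext_comp[OF vlinear_comp[OF vlinear_of_coords mult_linear_right],
        of "e s" bvec v] by (simp add: lin_ext_bvec_id)
  finally show ?thesis .
qed

abbreviation origin :: "'g \<times> nat \<Rightarrow>\<^sub>0 'k" where "origin \<equiv> bvec (\<one>\<^bsub>Grp D\<^esub>, 0)"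

lemma origin_model_space: "origin \<in> model_space D"
  using n_gt_1 by (intro bvec_model_space) auto

lemma of_coords_rep:
  assumes "u \<in> word_alg S"
  shows "of_coords (model_rep D u origin) = word_eval H e u"
proof -
  have *: "foldr (model_act D) w origin \<in> model_space D \<and>
      of_coords (foldr (model_act D) w origin) = foldr (\<lambda>s v. e s \<star> v) w \<eta>" if "w \<in> lists S" for w
    using that
  proof (induction w)
    case (Cons s w)
    then show ?case by (auto simp: of_coords_act intro: model_act_closed)
  qed (simp add: origin_model_space of_coords_bvec gx_group group_one)
  have "of_coords (model_rep D u origin) = lin_ext (\<lambda>w. of_coords (foldr (model_act D) w origin)) u"
    by (simp add: model_rep_def vlinear_lin_ext_comp[OF vlinear_of_coords])
  also have "\<dots> = word_eval H e u"
    unfolding word_eval_def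
    by (rule lin_ext_cong) (use * assms in \<open>auto simp: word_alg_def\<close>)
  finally show ?thesis .
qed

text \<open>
  The choice of a word does not matter: two words with the same value in \<open>H\<close> differ by an element of
  the ideal of relations, which acts as zero.
\<close>

definition coords :: "('b \<Rightarrow>\<^sub>0 'k) \<Rightarrow> ('g \<times> nat \<Rightarrow>\<^sub>0 'k)" where
  "coords y = model_rep D (SOME u. u \<in> word_alg S \<and> word_eval H e u = y) origin"

lemma coords_word_eval:
  assumes "u \<in> word_alg S"
  shows "coords (word_eval H e u) = model_rep D u origin"
proof -
  define u' where "u' = (SOME u'. u' \<in> word_alg S \<and> word_eval H e u' = word_eval H e u)"
  have u': "u' \<in> word_alg S" "word_eval H e u' = word_eval H e u"
    using someI_ex[of "\<lambda>u'. u' \<in> word_alg S \<and> word_eval H e u' = word_eval H e u"] assms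
    unfolding u'_def by blast+
  then have "u' - u \<in> ideal_generated S (relations D)"
    using assms unfolding kernel[symmetric]
    by (simp add: vlinear_diff[OF vlinear_word_eval] word_alg_closed)
  from model_rep_ideal[OF this origin_model_space] show ?thesis
    by (simp add: coords_def u'_def[symmetric] vbilinear_simps[OF vbilinear_model_rep])
qed

lemma vlinear_coords: "vlinear coords"
proof (rule vlinearI)
  fix y z :: "'b \<Rightarrow>\<^sub>0 'k" and c
  obtain u v where uv: "u \<in> word_alg S" "word_eval H e u = y" "v \<in> word_alg S" "word_eval H e v = z"
    using ex_word by metis
  show "coords (y + z) = coords y + coords z"
    using coords_word_eval[of "u + v"] coords_word_eval[of u] coords_word_eval[of v] uv
    by (simp add: word_alg_closed vlinear_add[OF vlinear_word_eval]
        vbilinear_simps[OF vbilinear_model_rep])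
  show "coords (vscale c z) = vscale c (coords z)"
    using coords_word_eval[of "vscale c v"] coords_word_eval[of v] uv
    by (simp add: word_alg_closed vlinear_scale[OF vlinear_word_eval]
        vbilinear_simps[OF vbilinear_model_rep])
qed

lemma of_coords_coords: "of_coords (coords y) = y"
  using ex_word[of y] coords_word_eval of_coords_rep by metis

lemma coords_model_space: "coords y \<in> model_space D"
  using ex_word[of y] coords_word_eval model_rep_closed origin_model_space by metis

lemma coords_gx:
  assumes "g \<in> carrier (Grp D)" "m < n"
  shows "coords (gx g m) = bvec (g, m)"
proof -
  let ?w = "Gen g # replicate m X"
  have w: "bvec ?w \<in> word_alg S"
    using assms by (intro word_alg_closed) (auto simp: generators_def in_lists_conv_set)
  have "word_eval H e (bvec ?w) = gx g m"
    by (simp add: word_eval_bvec gx_def xpow_def)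
  with coords_word_eval[OF w] show ?thesis
    using assms
    by (simp add: model_rep_bvec model_X_pow chi_one vlinear_scale[OF vlinear_model_act])
qed

lemma coords_group: "g \<in> carrier (Grp D) \<Longrightarrow> coords (\<iota> g) = bvec (g, 0)"
  using coords_gx[of g 0] n_gt_1 by (simp add: gx_group)

lemma coords_one: "coords \<eta> = bvec (\<one>\<^bsub>Grp D\<^esub>, 0)"
  by (simp add: coords_group flip: group_one)

lemma coords_x: "coords x = bvec (\<one>\<^bsub>Grp D\<^esub>, 1)"
  using coords_gx[of "\<one>\<^bsub>Grp D\<^esub>" 1] n_gt_1 by (simp add: gx_x)

lemma \<iota>_inj: "inj_on \<iota> (carrier (Grp D))"
proof (rule inj_onI)
  fix g h assume "g \<in> carrier (Grp D)" "h \<in> carrier (Grp D)" "\<iota> g = \<iota> h"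
  then have "bvec (g, 0) = (bvec (h, 0) :: 'g \<times> nat \<Rightarrow>\<^sub>0 'k)"
    by (metis coords_group)
  from arg_cong[OF this, of Poly_Mapping.keys] show "g = h" by simp
qed

lemma \<iota>_nonzero:
  assumes "g \<in> carrier (Grp D)"
  shows "\<iota> g \<noteq> 0"
proof
  assume "\<iota> g = 0"
  then have "bvec (g, 0) = (0 :: 'g \<times> nat \<Rightarrow>\<^sub>0 'k)"
    using coords_group[OF assms] vlinear_0[OF vlinear_coords] by simp
  from arg_cong[OF this, of Poly_Mapping.keys] show False by simp
qed

lemma x_nonzero: "x \<noteq> 0"
proof
  assume "x = 0"
  then have "bvec (\<one>\<^bsub>Grp D\<^esub>, 1) = (0 :: 'g \<times> nat \<Rightarrow>\<^sub>0 'k)"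
    using coords_x vlinear_0[OF vlinear_coords] by simp
  from arg_cong[OF this, of Poly_Mapping.keys] show False by simp
qed

lemma coords_inj: "coords y = coords z \<Longrightarrow> y = z"
  using of_coords_coords by metis

lemma lookup_linear_coords:
  assumes "vlinear L"
  shows "Poly_Mapping.lookup (L y) c = (\<Sum>(g, m)\<in>Poly_Mapping.keys (coords y).
    Poly_Mapping.lookup (coords y) (g, m) * Poly_Mapping.lookup (L (gx g m)) c)"
proof -
  have "L y = L (of_coords (coords y))" by (simp add: of_coords_coords)
  also have "\<dots> = lin_ext (\<lambda>(g, m). L (gx g m)) (coords y)"
    by (simp add: of_coords_def vlinear_lin_ext_comp[OF assms] case_prod_unfold)
  finally show ?thesis
    by (simp add: lin_ext_def lookup_sum case_prod_unfold)
qed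

lemma keys_coords: "(g, m) \<in> Poly_Mapping.keys (coords y) \<Longrightarrow> g \<in> carrier (Grp D) \<and> m < n"
  using coords_model_space[of y] by (auto simp: model_space_def)

lemma span_induct:
  assumes "\<And>u v. P u \<Longrightarrow> P v \<Longrightarrow> P (u + v)" "\<And>c u. P u \<Longrightarrow> P (vscale c u)" "P 0"
    "\<And>g m. g \<in> carrier (Grp D) \<Longrightarrow> P (gx g m)"
  shows "P y"
proof -
  have "P (\<Sum>(g, m)\<in>A. vscale (Poly_Mapping.lookup (coords y) (g, m)) (gx g m))"
    if "A \<subseteq> Poly_Mapping.keys (coords y)" for A
    using finite_subset[OF that] that
    by (induction A rule: finite_induct) (auto simp: assms keys_coords[THEN conjunct1])
  from this[of "Poly_Mapping.keys (coords y)"] show ?thesis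
    using of_coords_coords[of y] by (simp add: of_coords_def lin_ext_def case_prod_unfold)
qed

section \<open>Comultiplication in coordinates\<close>

text \<open>
  The Gaussian binomial coefficients at \<open>q = \<chi>(a)\<close>, in the form in which they arise when
  \<open>x \<otimes> a + 1 \<otimes> x\<close> is multiplied from the right; \<open>q\<^sup>m\<^sup>-\<^sup>i\<close> comes from moving \<open>a\<close> past
  \<open>x\<^sup>m\<^sup>-\<^sup>i\<close>.
\<close>

fun qbinom :: "nat \<Rightarrow> nat \<Rightarrow> 'k" where
  "qbinom 0 0 = 1"
| "qbinom 0 (Suc i) = 0"
| "qbinom (Suc m) 0 = qbinom m 0"
| "qbinom (Suc m) (Suc i) = qbinom m (Suc i) + q ^ (m - i) * qbinom m i"

lemma qbinom_0 [simp]: "qbinom m 0 = 1"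
  by (induction m) auto

lemma qbinom_eq_0: "m < i \<Longrightarrow> qbinom m i = 0"
proof (induction m arbitrary: i)
  case (Suc m)
  then show ?case by (cases i) auto
qed (auto simp: gr0_conv_Suc)

lemma qbinom_1: "qbinom m 1 * (q - 1) = q ^ m - 1"
  by (induction m) (auto simp: algebra_simps)

lemma comult_mult_x: "comult H (u \<star> x) = sw H u (\<lambda>u1 u2. (u1 \<star> x) \<otimes>\<^sub>k (u2 \<star> \<iota> a) + u1 \<otimes>\<^sub>k (u2 \<star> x))"
proof -
  have "sw H x (\<lambda>v1 v2. (u1 \<star> v1) \<otimes>\<^sub>k (u2 \<star> v2)) =
      (u1 \<star> x) \<otimes>\<^sub>k (u2 \<star> \<iota> a) + u1 \<otimes>\<^sub>k (u2 \<star> x)" for u1 u2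
    using sw_tens_add[OF comult_x vbilinear_comp2[OF vbilinear_tens mult_linear_right mult_linear_right]]
    by (simp add: one_right)
  then show ?thesis by (simp add: comult_mult)
qed

lemma comult_gx:
  assumes g: "g \<in> carrier (Grp D)"
  shows "comult H (gx g m) = (\<Sum>i\<le>m. vscale (qbinom m i)
    (gx g i \<otimes>\<^sub>k gx (g \<otimes>\<^bsub>Grp D\<^esub> a [^]\<^bsub>Grp D\<^esub> i) (m - i)))"
proof (induction m)
  case 0
  then show ?case using g by (simp add: gx_group comult_group)
next
  case (Suc m)
  let ?ga = "\<lambda>i. g \<otimes>\<^bsub>Grp D\<^esub> a [^]\<^bsub>Grp D\<^esub> (i :: nat)"
  let ?B = "\<lambda>u1 u2. (u1 \<star> x) \<otimes>\<^sub>k (u2 \<star> \<iota> a) + u1 \<otimes>\<^sub>k (u2 \<star> x)"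
  let ?t = "\<lambda>i. gx g i \<otimes>\<^sub>k gx (?ga i) (Suc m - i)"
  have B: "vbilinear ?B"
    by (intro vbilinear_plus vbilinear_comp2[OF vbilinear_tens] mult_linear_left vlinear_id)
  have ga: "?ga i \<otimes>\<^bsub>Grp D\<^esub> a = ?ga (Suc i)" for i
    using g elt by (simp add: G.m_assoc)
  have "comult H (gx g (Suc m)) = sw H (gx g m) ?B"
    by (simp add: comult_mult_x flip: gx_mult_x)
  also have "\<dots> = (\<Sum>i\<le>m. vscale (qbinom m i) (?B (gx g i) (gx (?ga i) (m - i))))"
    by (simp add: sw_def Suc vlinear_sum[OF vlinear_tlin] vlinear_scale[OF vlinear_tlin]
        tlin_tens[OF B])
  also have "\<dots> = (\<Sum>i\<le>m. vscale (q ^ (m - i) * qbinom m i) (?t (Suc i)) + vscale (qbinom m i) (?t i))"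
    using g elt
    by (intro sum.cong refl)
      (simp add: gx_mult_x gx_group_right ga tens_simps vscale_add Suc_diff_le mult.commute
        del: G.nat_pow_Suc)
  also have "\<dots> = (\<Sum>i\<le>m. vscale (q ^ (m - i) * qbinom m i) (?t (Suc i))) +
      (\<Sum>i\<le>Suc m. vscale (qbinom m i) (?t i))"
    by (simp add: sum.distrib qbinom_eq_0)
  also have "\<dots> = (\<Sum>i\<le>Suc m. vscale (qbinom (Suc m) i) (?t i))"
    unfolding sum.atMost_Suc_shift
    by (simp add: vscale_add_left sum.distrib algebra_simps)
  finally show ?case .
qed

text \<open>
  Each coordinate of \<open>\<Delta>(y)\<close> involves a single coordinate of \<open>y\<close>: the term
  \<open>h x\<^sup>k \<otimes> h' x\<^sup>k\<^sup>'\<close> can only come from \<open>h x\<^sup>k\<^sup>+\<^sup>k\<^sup>'\<close>, and only if \<open>h' = h a\<^sup>k\<close>. Both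
  classifications below are read off from this formula.
\<close>

lemma lookup_coords_comult:
  assumes h: "h \<in> carrier (Grp D)"
  shows "Poly_Mapping.lookup (tlin (\<lambda>u v. coords u \<otimes>\<^sub>k coords v) (comult H y)) ((h, k), (h', k')) =
    (if h' = h \<otimes>\<^bsub>Grp D\<^esub> a [^]\<^bsub>Grp D\<^esub> k \<and> k + k' < n
     then qbinom (k + k') k * Poly_Mapping.lookup (coords y) (h, k + k') else 0)"
proof -
  let ?L = "\<lambda>y. tlin (\<lambda>u v. coords u \<otimes>\<^sub>k coords v) (comult H y)"
  let ?ga = "\<lambda>g i. g \<otimes>\<^bsub>Grp D\<^esub> a [^]\<^bsub>Grp D\<^esub> (i :: nat)"
  have L: "Poly_Mapping.lookup (?L (gx g m)) ((h, k), (h', k')) =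
      (if (h, k + k') = (g, m) then if h' = ?ga h k then qbinom m k else 0 else 0)"
    if g: "g \<in> carrier (Grp D)" and m: "m < n" for g m
  proof -
    have "?L (gx g m) = (\<Sum>i\<le>m. vscale (qbinom m i) (bvec ((g, i), (?ga g i, m - i))))"
      using g m elt
      by (simp add: comult_gx vlinear_sum[OF vlinear_tlin] vlinear_scale[OF vlinear_tlin]
          tlin_tens vbilinear_comp2[OF vbilinear_tens] vlinear_coords coords_gx)
    also have "Poly_Mapping.lookup \<dots> ((h, k), (h', k')) =
        (\<Sum>i\<le>m. if i = k then if g = h \<and> ?ga g k = h' \<and> m - k = k' then qbinom m k else 0 else 0)"
      unfolding lookup_sum by (intro sum.cong refl) (auto simp: lookup_single when_def)
    finally show ?thesis by auto
  qed
  have "Poly_Mapping.lookup (?L y) ((h, k), (h', k')) = (\<Sum>(g, m)\<in>Poly_Mapping.keys (coords y).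
      Poly_Mapping.lookup (coords y) (g, m) * Poly_Mapping.lookup (?L (gx g m)) ((h, k), (h', k')))"
    by (rule lookup_linear_coords[OF vlinear_comp[OF linear_comult vlinear_tlin]])
  also have "\<dots> = (\<Sum>b\<in>Poly_Mapping.keys (coords y). if b = (h, k + k') then
      (if h' = ?ga h k then qbinom (k + k') k * Poly_Mapping.lookup (coords y) (h, k + k') else 0) else 0)"
  proof (intro sum.cong refl, goal_cases)
    case (1 b)
    moreover obtain g m where "b = (g, m)" by fastforce
    ultimately show ?case using L[of g m] keys_coords[of g m y] by (auto split: if_splits)
  qed
  also have "\<dots> = (if h' = ?ga h k \<and> k + k' < n
     then qbinom (k + k') k * Poly_Mapping.lookup (coords y) (h, k + k') else 0)"
    using keys_coords[of h "k + k'" y] by (auto simp: in_keys_iff)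
  finally show ?thesis .
qed

text \<open>
  Comparing coordinates at \<open>k = 0\<close> shows that only one group element \<open>g\<close> occurs in \<open>y\<close>; at
  \<open>k' = 0\<close> it shows that \<open>g x\<^sup>k\<close> occurs only if \<open>a\<^sup>k = 1\<close>. Then \<open>q\<^sup>k = 1\<close>, so \<open>k = 0\<close>
  because \<open>k < n\<close>.
\<close>

lemma grouplike_in_group:
  assumes y: "comult H y = y \<otimes>\<^sub>k y" and "y \<noteq> 0"
  obtains g where "g \<in> carrier (Grp D)" "y = \<iota> g"
proof -
  define Y where "Y = (\<lambda>g m. Poly_Mapping.lookup (coords y) (g, m))"
  have Y: "Y h k * Y h' k' = (if h' = h \<otimes>\<^bsub>Grp D\<^esub> a [^]\<^bsub>Grp D\<^esub> k \<and> k + k' < n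
      then qbinom (k + k') k * Y h (k + k') else 0)" if "h \<in> carrier (Grp D)" for h k h' k'
    using lookup_coords_comult[OF that, of y k h' k'] y
    by (simp add: Y_def tlin_tens vbilinear_comp2[OF vbilinear_tens] vlinear_coords)
  have nz: "Y g m \<noteq> 0 \<Longrightarrow> g \<in> carrier (Grp D) \<and> m < n" for g m
    unfolding Y_def using keys_coords by (simp add: in_keys_iff)
  have "coords y \<noteq> 0"
    using \<open>y \<noteq> 0\<close> coords_inj[of y 0] by (auto simp: vlinear_0[OF vlinear_coords])
  then obtain g m where gm: "Y g m \<noteq> 0"
    unfolding Y_def by (metis lookup_zero poly_mapping_eqI surj_pair)
  have Y0: "Y h 0 = (if h = g then 1 else 0)" if "h \<in> carrier (Grp D)" for h
    using Y[OF that, of 0 g m] gm nz[OF gm] that by auto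
  have *: "h = g \<and> k = 0" if hk: "Y h k \<noteq> 0" for h k
  proof -
    note h = nz[OF hk]
    have "h = g" using Y[of g 0 h k] Y0[of g] nz[OF gm] hk h by (auto split: if_splits)
    moreover have "h = h \<otimes>\<^bsub>Grp D\<^esub> a [^]\<^bsub>Grp D\<^esub> k"
    proof (rule ccontr)
      assume "h \<noteq> h \<otimes>\<^bsub>Grp D\<^esub> a [^]\<^bsub>Grp D\<^esub> k"
      then have "Y h k * Y h 0 = 0" using Y[of h k h 0] h by simp
      then show False using Y0[of h] h hk \<open>h = g\<close> by simp
    qed
    then have "a [^]\<^bsub>Grp D\<^esub> k = \<one>\<^bsub>Grp D\<^esub>"
      using h elt by (metis G.l_cancel_one G.nat_pow_closed)
    then have "q ^ k = 1"
      using chi_pow[OF elt, of k] chi_one by simp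
    then have "n dvd k" by (simp only: q_pow_eq_1_iff)
    then have "k = 0" using h by (metis dvd_imp_le gr0I not_le)
    ultimately show ?thesis by simp
  qed
  have "coords y = bvec (g, 0)"
  proof (rule poly_mapping_eqI)
    fix b :: "'g \<times> nat"
    obtain h k where b: "b = (h, k)" by fastforce
    have "Y h k = (if h = g \<and> k = 0 then 1 else 0)"
    proof (cases "h = g \<and> k = 0")
      case False
      then have "Y h k = 0" using * by blast
      then show ?thesis using False by simp
    qed (use Y0[OF conjunct1[OF nz[OF gm]]] in simp)
    then show "Poly_Mapping.lookup (coords y) b = Poly_Mapping.lookup (bvec (g, 0)) b"
      by (auto simp: b lookup_single when_def Y_def)
  qed
  then have "y = \<iota> g"
    using of_coords_coords[of y] by (simp add: of_coords_bvec gx_group)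
  then show thesis using that nz[OF gm] by blast
qed

text \<open>
  The coordinates of degree \<open>m \<ge> 2\<close> vanish because the coefficient \<open>1 + q + \<dots> + q\<^sup>m\<^sup>-\<^sup>1\<close> of
  \<open>h x \<otimes> h a x\<^sup>m\<^sup>-\<^sup>1\<close> in the comultiplication of \<open>h x\<^sup>m\<close> is nonzero for \<open>m < n\<close>. In degree 1 only
  \<open>x\<close> itself survives. The trivial skew-primitives, multiples of \<open>b - 1\<close>, commute with \<open>b\<close>, and the
  commutation hypothesis with \<open>c \<noteq> 1\<close> excludes them.
\<close>

lemma skew_primitive_multiple_of_x:
  assumes y: "comult H y = y \<otimes>\<^sub>k \<iota> b + \<eta> \<otimes>\<^sub>k y" and b: "b \<in> carrier (Grp D)"
    and central_b: "\<And>g. g \<in> carrier (Grp D) \<Longrightarrow> b \<otimes>\<^bsub>Grp D\<^esub> g = g \<otimes>\<^bsub>Grp D\<^esub> b"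
    and comm: "y \<star> \<iota> b = vscale c (\<iota> b \<star> y)" and c: "c \<noteq> 1"
  obtains t where "y = vscale t x"
proof -
  define Y where "Y = (\<lambda>g m. Poly_Mapping.lookup (coords y) (g, m))"
  have Y: "Y h k * (if h' = b \<and> k' = 0 then 1 else 0) +
      (if h = \<one>\<^bsub>Grp D\<^esub> \<and> k = 0 then 1 else 0) * Y h' k' =
      (if h' = h \<otimes>\<^bsub>Grp D\<^esub> a [^]\<^bsub>Grp D\<^esub> k \<and> k + k' < n
      then qbinom (k + k') k * Y h (k + k') else 0)" if "h \<in> carrier (Grp D)" for h k h' k'
  proof -
    have "Poly_Mapping.lookup (tlin (\<lambda>u v. coords u \<otimes>\<^sub>k coords v) (comult H y)) ((h, k), (h', k')) =
        Y h k * (1 when (b, 0) = (h', k')) + (1 when (\<one>\<^bsub>Grp D\<^esub>, 0) = (h, k)) * Y h' k'"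
      using b by (simp add: y Y_def tlin_tens vbilinear_comp2[OF vbilinear_tens] vlinear_coords
          vlinear_add[OF vlinear_tlin] lookup_add lookup_single coords_group coords_one)
    also have "((1 :: 'k) when (b, 0) = (h', k')) = (if h' = b \<and> k' = 0 then 1 else 0)"
      by (auto simp: when_def)
    also have "((1 :: 'k) when (\<one>\<^bsub>Grp D\<^esub>, 0) = (h, k)) = (if h = \<one>\<^bsub>Grp D\<^esub> \<and> k = 0 then 1 else 0)"
      by (auto simp: when_def)
    finally show ?thesis
      unfolding lookup_coords_comult[OF that] Y_def by (rule sym)
  qed
  have nz: "Y g m \<noteq> 0 \<Longrightarrow> g \<in> carrier (Grp D) \<and> m < n" for g m
    unfolding Y_def using keys_coords by (simp add: in_keys_iff)
  have Y0: "Y h 0 = 0" for h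
  proof (cases "h \<in> carrier (Grp D)")
    case h: True
    let ?hb = "h \<otimes>\<^bsub>Grp D\<^esub> b"
    have "Poly_Mapping.lookup (coords (y \<star> \<iota> b)) (?hb, 0) = (\<Sum>(g, m)\<in>Poly_Mapping.keys (coords y).
        Y g m * Poly_Mapping.lookup (coords (gx g m \<star> \<iota> b)) (?hb, 0))"
      unfolding Y_def by (rule lookup_linear_coords[OF vlinear_comp[OF mult_linear_left vlinear_coords]])
    also have "\<dots> = (\<Sum>g\<in>Poly_Mapping.keys (coords y). if g = (h, 0) then Y h 0 else 0)"
    proof (intro sum.cong refl, goal_cases)
      case (1 i)
      moreover obtain g m where "i = (g, m)" by fastforce
      ultimately show ?case using h b keys_coords[of g m y]
        by (auto simp: gx_group_right coords_gx vlinear_scale[OF vlinear_coords] lookup_single when_def)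
    qed
    also have "\<dots> = Y h 0"
      by (auto simp: Y_def in_keys_iff)
    finally have 1: "Poly_Mapping.lookup (coords (y \<star> \<iota> b)) (?hb, 0) = Y h 0" .
    have "Poly_Mapping.lookup (coords (\<iota> b \<star> y)) (?hb, 0) = (\<Sum>(g, m)\<in>Poly_Mapping.keys (coords y).
        Y g m * Poly_Mapping.lookup (coords (\<iota> b \<star> gx g m)) (?hb, 0))"
      unfolding Y_def by (rule lookup_linear_coords[OF vlinear_comp[OF mult_linear_right vlinear_coords]])
    also have "\<dots> = (\<Sum>g\<in>Poly_Mapping.keys (coords y). if g = (h, 0) then Y h 0 else 0)"
    proof (intro sum.cong refl, goal_cases)
      case (1 i)
      moreover obtain g m where "i = (g, m)" by fastforce
      ultimately show ?case using h b keys_coords[of g m y]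
        by (auto simp: group_gx coords_gx central_b lookup_single when_def)
    qed
    also have "\<dots> = Y h 0"
      by (auto simp: Y_def in_keys_iff)
    finally have "Y h 0 = c * Y h 0"
      using 1 comm by (simp add: vlinear_scale[OF vlinear_coords])
    then show ?thesis using c by simp
  qed (use nz in blast)
  have Y1: "Y h 1 = 0" if "h \<noteq> \<one>\<^bsub>Grp D\<^esub>" for h
    using Y[of h 0 h 1] that nz[of h 1] by (cases "Y h 1 = 0") auto
  have Y2: "Y h (Suc (Suc m)) = 0" for h m
  proof (rule ccontr)
    assume "Y h (Suc (Suc m)) \<noteq> 0"
    moreover from this have h: "h \<in> carrier (Grp D)" "Suc (Suc m) < n" using nz by auto
    ultimately have "qbinom (Suc (Suc m)) 1 = 0"
      using Y[of h 1 "h \<otimes>\<^bsub>Grp D\<^esub> a [^]\<^bsub>Grp D\<^esub> (1::nat)" "Suc m"] by simp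
    then have "q ^ Suc (Suc m) = 1" using qbinom_1[of "Suc (Suc m)"] by simp
    then have "n dvd Suc (Suc m)" by (simp only: q_pow_eq_1_iff)
    then show False using h by (meson dvd_imp_le not_le zero_less_Suc)
  qed
  have "coords y = vscale (Y \<one>\<^bsub>Grp D\<^esub> 1) (bvec (\<one>\<^bsub>Grp D\<^esub>, 1))"
  proof (rule poly_mapping_eqI)
    fix b :: "'g \<times> nat"
    obtain h k where b: "b = (h, k)" by fastforce
    consider "k = 0" | "k = 1" | m where "k = Suc (Suc m)"
      by (metis One_nat_def not0_implies_Suc)
    then have "Y h k = (if h = \<one>\<^bsub>Grp D\<^esub> \<and> k = 1 then Y \<one>\<^bsub>Grp D\<^esub> 1 else 0)"
      using Y0 Y1 Y2 by cases auto
    moreover have "Poly_Mapping.lookup (coords y) b = Y h k"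
      by (simp add: b Y_def)
    moreover have "Poly_Mapping.lookup (vscale t (bvec (\<one>\<^bsub>Grp D\<^esub>, 1))) b =
        (if h = \<one>\<^bsub>Grp D\<^esub> \<and> k = 1 then t else 0)" for t :: 'k
      by (auto simp: b lookup_single when_def)
    ultimately show "Poly_Mapping.lookup (coords y) b =
        Poly_Mapping.lookup (vscale (Y \<one>\<^bsub>Grp D\<^esub> 1) (bvec (\<one>\<^bsub>Grp D\<^esub>, 1))) b"
      by (simp only:)
  qed
  then have "y = vscale (Y \<one>\<^bsub>Grp D\<^esub> 1) x"
    using of_coords_coords[of y] by (simp add: vlinear_scale[OF vlinear_of_coords] of_coords_bvec gx_x)
  then show thesis using that by blast
qed

end

section \<open>Hopf q-braces on rank one Hopf algebras\<close>

text \<open>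
  The consequences of the axioms of a Hopf q-brace on which the argument rests, for the bilinear maps
  \<open>dt u v = u \<cdot> v\<close> and \<open>cl u v = u : v\<close>. This list is invariant under
  exchanging the two operations (\<open>brace_ops_swap\<close>), so every result about \<open>\<cdot>\<close> derived from it also holds for the other operation.
\<close>

locale brace_ops = hopf_algebra H
  for H :: "('b, 'k::field, 'm) hopf_scheme" (structure)
    and dt cl :: "('b \<Rightarrow>\<^sub>0 'k) \<Rightarrow> ('b \<Rightarrow>\<^sub>0 'k) \<Rightarrow> ('b \<Rightarrow>\<^sub>0 'k)" +
  assumes vbilinear_dt: "vbilinear dt"
    and vbilinear_cl: "vbilinear cl"
    and counit_dt: "counit H (dt u v) = counit H u * counit H v"
    and counit_cl: "counit H (cl u v) = counit H u * counit H v"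
    and comult_dt: "comult H (dt u v) = sw H u (\<lambda>u1 u2. sw H v (\<lambda>v1 v2. dt u1 v2 \<otimes>\<^sub>k dt u2 v1))"
    and comult_cl: "comult H (cl u v) = sw H u (\<lambda>u1 u2. sw H v (\<lambda>v1 v2. cl u1 v2 \<otimes>\<^sub>k cl u2 v1))"
    and exchange: "sw H u (\<lambda>u1 u2. sw H v (\<lambda>v1 v2. cl v1 u2 \<otimes>\<^sub>k dt u1 v2)) =
      sw H u (\<lambda>u1 u2. sw H v (\<lambda>v1 v2. cl v2 u1 \<otimes>\<^sub>k dt u2 v1))"
    and dt_one: "dt h \<eta> = h"
    and cl_one: "cl h \<eta> = h"
    and dt_mult: "dt h (k \<star> l) = dt (dt h l) k"
    and cl_mult: "cl h (k \<star> l) = cl (cl h l) k"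
    and mult_dt: "dt (h \<star> k) l = sw H k (\<lambda>k1 k2. sw H l (\<lambda>l1 l2. dt h (cl l1 k2) \<star> dt k1 l2))"
    and mult_cl: "cl (h \<star> k) l = sw H k (\<lambda>k1 k2. sw H l (\<lambda>l1 l2. cl h (dt l1 k2) \<star> cl k1 l2))"

lemma brace_ops_swap:
  assumes "brace_ops H dt cl"
  shows "brace_ops H cl dt"
proof -
  interpret brace_ops H dt cl by fact
  have flip: "tlin (\<lambda>s t. t \<otimes>\<^sub>k s) (s \<otimes>\<^sub>k t) = t \<otimes>\<^sub>k s" for s t :: "'a \<Rightarrow>\<^sub>0 'b"
    by (simp add: tlin_tens vbilinear_flip[OF vbilinear_tens])
  have exchange': "sw H u (\<lambda>u1 u2. sw H v (\<lambda>v1 v2. dt v1 u2 \<otimes>\<^sub>k cl u1 v2)) =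
      sw H u (\<lambda>u1 u2. sw H v (\<lambda>v1 v2. dt v2 u1 \<otimes>\<^sub>k cl u2 v1))" for u v
    using arg_cong[OF exchange[of v u], of "tlin (\<lambda>s t. t \<otimes>\<^sub>k s)"]
    by (simp add: sw_comp[OF vlinear_tlin] flip) (simp add: sw_swap[of H v])
  show ?thesis
    by unfold_locales
      (fact vbilinear_dt vbilinear_cl counit_dt counit_cl comult_dt comult_cl exchange'
        dt_one cl_one dt_mult cl_mult mult_dt mult_cl)+
qed

lemma hopf_q_brace_ops:
  assumes "hopf_q_brace H p d"
  shows "brace_ops H (\<lambda>u v. p (u \<otimes>\<^sub>k v)) (\<lambda>u v. d (u \<otimes>\<^sub>k v))"
proof -
  interpret hopf_q_brace H p d by fact
  show ?thesis
    by unfold_locales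
      (fact vbilinear_dot vbilinear_colon counit_p counit_d comult_dot comult_colon exchange
        dot_one[unfolded dot_def] colon_one[unfolded colon_def]
        dot_mult[unfolded dot_def] colon_mult[unfolded colon_def]
        mult_dot[unfolded dot_def colon_def] mult_colon[unfolded dot_def colon_def])+
qed

context rank_one_hopf_algebra
begin

lemma sw_group: "g \<in> carrier (Grp D) \<Longrightarrow> vbilinear B \<Longrightarrow> sw H (\<iota> g) B = B (\<iota> g) (\<iota> g)"
  by (rule sw_tens[OF comult_group])

lemma sw_one: "vbilinear B \<Longrightarrow> sw H \<eta> B = B \<eta> \<eta>"
  by (rule sw_tens[OF comult_one])

lemma sw_x: "vbilinear B \<Longrightarrow> sw H x B = B x (\<iota> a) + B \<eta> x"
  by (rule sw_tens_add[OF comult_x])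

lemma counit_group:
  assumes "g \<in> carrier (Grp D)"
  shows "counit H (\<iota> g) = 1"
proof -
  have "vscale (counit H (\<iota> g)) (\<iota> g) = \<iota> g"
    using counit_left[of "\<iota> g"] by (simp add: sw_group[OF assms vbilinear_counit])
  then have "vscale (counit H (\<iota> g) - 1) (\<iota> g) = 0"
    using vscale_add_left[of "counit H (\<iota> g) - 1" 1 "\<iota> g"] by simp
  then show ?thesis using \<iota>_nonzero[OF assms] by (simp add: vscale_eq_0_iff)
qed

end

locale rank_one_brace = rank_one_hopf_algebra D H \<iota> x + brace_ops H dt cl
  for D :: "('g, 'k::field) rank_one_data"
    and H :: "('b, 'k, 'm) hopf_scheme" (structure)
    and \<iota> :: "'g \<Rightarrow> ('b \<Rightarrow>\<^sub>0 'k)"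
    and x :: "'b \<Rightarrow>\<^sub>0 'k"
    and dt cl
    and l \<xi> :: "'g \<Rightarrow> 'k" +
  assumes l_character: "l \<in> characters (Grp D)"
    and \<xi>_character: "\<xi> \<in> characters (Grp D)"
    and dt_x_group: "g \<in> carrier (Grp D) \<Longrightarrow> dt x (\<iota> g) = vscale (l g) x"
    and cl_x_group: "g \<in> carrier (Grp D) \<Longrightarrow> cl x (\<iota> g) = vscale (\<xi> g) x"
    and dt_x_x: "dt x x = 0"
    and cl_x_x: "cl x x = 0"
begin

interpretation G: group "Grp D" by (rule group)

lemma swapped: "rank_one_brace D H \<iota> x cl dt \<xi> l"
  by (rule rank_one_brace.intro[OF rank_one_hopf_algebra_axioms brace_ops_swap[OF brace_ops_axioms]],
      rule rank_one_brace_axioms.intro)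
    (fact l_character \<xi>_character dt_x_group cl_x_group dt_x_x cl_x_x)+

lemma \<xi>_nonzero: "g \<in> carrier (Grp D) \<Longrightarrow> \<xi> g \<noteq> 0"
  using \<xi>_character by (auto simp: hom_def field_units_def)

lemma vlinear_ops:
  assumes "vlinear f"
  shows "vlinear (\<lambda>u. dt (f u) c)" "vlinear (\<lambda>u. dt c (f u))"
    "vlinear (\<lambda>u. cl (f u) c)" "vlinear (\<lambda>u. cl c (f u))"
    "vlinear (\<lambda>u. f u \<star> c)" "vlinear (\<lambda>u. c \<star> f u)"
    "vlinear (\<lambda>u. f u \<otimes>\<^sub>k w)" "vlinear (\<lambda>u. w \<otimes>\<^sub>k f u)"
  using vlinear_comp[OF assms vbilinearD(1)[OF vbilinear_dt]]
    vlinear_comp[OF assms vbilinearD(2)[OF vbilinear_dt]]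
    vlinear_comp[OF assms vbilinearD(1)[OF vbilinear_cl]]
    vlinear_comp[OF assms vbilinearD(2)[OF vbilinear_cl]]
    vlinear_comp[OF assms mult_linear_left] vlinear_comp[OF assms mult_linear_right]
    vlinear_comp[OF assms vbilinearD(1)[OF vbilinear_tens]]
    vlinear_comp[OF assms vbilinearD(2)[OF vbilinear_tens]]
  by auto

lemmas sw_simps = sw_group sw_x sw_one vbilinear_def vlinear_ops vlinear_sw_param vlinear_plus vlinear_id

text \<open>
  By \<open>comult_dt\<close> the product of two group-likes is group-like, hence a group element.
\<close>

lemma dt_group:
  assumes "g \<in> carrier (Grp D)" "h \<in> carrier (Grp D)"
  obtains k where "k \<in> carrier (Grp D)" "dt (\<iota> g) (\<iota> h) = \<iota> k"
proof -
  let ?y = "dt (\<iota> g) (\<iota> h)"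
  have "comult H ?y = ?y \<otimes>\<^sub>k ?y"
    using assms by (simp add: comult_dt sw_simps)
  moreover have "counit H ?y = 1"
    using assms by (simp add: counit_dt counit_group)
  then have "?y \<noteq> 0"
    using counit_simps(2)[of 0 0] by auto
  ultimately show thesis
    using that grouplike_in_group by blast
qed

text \<open>
  The formula for \<open>hk \<cdot> l\<close> with \<open>h = k = 1\<close> makes \<open>1 \<cdot> g\<close> an idempotent of the group.
\<close>

lemma dt_one_group:
  assumes g: "g \<in> carrier (Grp D)"
  shows "dt \<eta> (\<iota> g) = \<eta>"
proof -
  obtain k where k: "k \<in> carrier (Grp D)" "dt \<eta> (\<iota> g) = \<iota> k"
    using dt_group[OF G.one_closed g] unfolding group_one by blast
  have "dt (\<eta> \<star> \<eta>) (\<iota> g) = dt \<eta> (\<iota> g) \<star> dt \<eta> (\<iota> g)"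
    using g by (simp add: mult_dt sw_simps cl_one)
  then have "\<iota> k = \<iota> (k \<otimes>\<^bsub>Grp D\<^esub> k)"
    using k by (simp add: one_left group_mult)
  then have "k = k \<otimes>\<^bsub>Grp D\<^esub> k"
    using \<iota>_inj k by (meson G.m_closed inj_onD)
  then show ?thesis
    using k G.l_cancel_one group_one by metis
qed

lemma dt_one_x: "dt \<eta> x = 0"
  using mult_dt[of \<eta> \<eta> x]
  by (simp add: sw_simps cl_one dt_one dt_one_group elt one_left one_right)

lemmas cl_one_group = rank_one_brace.dt_one_group[OF swapped]
lemmas cl_one_x = rank_one_brace.dt_one_x[OF swapped]

text \<open>
  Write \<open>b = a : g\<close>, which differs from 1 because \<open>(- : g)\<close> is injective on group elements and fixes
  1. The exchange identity at \<open>g \<otimes> x\<close> reads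
  \<open>\<xi>(g) x \<otimes> (g \<cdot> a) + 1 \<otimes> (g \<cdot> x) = b \<otimes> (g \<cdot> x) + \<xi>(g) x \<otimes> g\<close>.
  Since \<open>1\<close>, \<open>b\<close> and \<open>x\<close> are linearly independent, the second factors can be compared.
\<close>

lemma dt_group_x_and_elt:
  assumes g: "g \<in> carrier (Grp D)"
  shows "dt (\<iota> g) x = 0 \<and> dt (\<iota> g) (\<iota> a) = \<iota> g"
proof -
  obtain b where b: "b \<in> carrier (Grp D)" "cl (\<iota> a) (\<iota> g) = \<iota> b"
    using rank_one_brace.dt_group[OF swapped elt g] by blast
  have "b \<noteq> \<one>\<^bsub>Grp D\<^esub>"
  proof
    assume "b = \<one>\<^bsub>Grp D\<^esub>"
    then have "cl (cl (\<iota> a) (\<iota> g)) (\<iota> (inv\<^bsub>Grp D\<^esub> g)) = \<eta>"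
      using g by (simp add: b group_one cl_one_group)
    moreover have "cl (cl (\<iota> a) (\<iota> g)) (\<iota> (inv\<^bsub>Grp D\<^esub> g)) = \<iota> a"
      using g by (simp add: group_mult group_one cl_one flip: cl_mult)
    ultimately have "a = \<one>\<^bsub>Grp D\<^esub>"
      using \<iota>_inj elt G.one_closed by (metis group_one inj_onD)
    then have "q ^ 1 = 1" by (simp add: chi_one)
    then show False using n_gt_1 by (simp only: q_pow_eq_1_iff) simp
  qed
  let ?y = "dt (\<iota> g) x" and ?z = "dt (\<iota> g) (\<iota> a)"
  have eq: "vscale (\<xi> g) x \<otimes>\<^sub>k ?z + \<eta> \<otimes>\<^sub>k ?y = \<iota> b \<otimes>\<^sub>k ?y + vscale (\<xi> g) x \<otimes>\<^sub>k \<iota> g"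
    using exchange[of "\<iota> g" x] g elt
    by (simp add: sw_simps cl_x_group cl_one_group b dt_one)
  \<comment> \<open>\<open>E c\<close> evaluates the first tensor factor at the coordinate \<open>c\<close>.\<close>
  define E where "E = (\<lambda>c. tlin (\<lambda>u v. vscale (Poly_Mapping.lookup (coords u) c) v) :: _ \<Rightarrow> ('b \<Rightarrow>\<^sub>0 'k))"
  have "vbilinear (\<lambda>u v. vscale (Poly_Mapping.lookup (coords u) c) (v :: 'b \<Rightarrow>\<^sub>0 'k))" for c
    by (intro vbilinearI vlinearI)
      (simp_all add: vlinear_add[OF vlinear_coords] vlinear_scale[OF vlinear_coords] lookup_add
        vscale_add vscale_add_left mult.commute)
  then have E: "E c (u \<otimes>\<^sub>k v) = vscale (Poly_Mapping.lookup (coords u) c) v" for c u v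
    by (simp add: E_def tlin_tens)
  have E_add: "E c (s + t) = E c s + E c t" for c s t
    unfolding E_def by (rule vlinear_add[OF vlinear_tlin])
  have "0 = ?y"
    using arg_cong[OF eq, of "E (b, 0)"] \<open>b \<noteq> \<one>\<^bsub>Grp D\<^esub>\<close> b(1)
    by (simp add: E E_add coords_group coords_x coords_one vlinear_scale[OF vlinear_coords]
        lookup_single)
  moreover have "vscale (\<xi> g) ?z = vscale (\<xi> g) (\<iota> g)"
    using arg_cong[OF eq, of "E (\<one>\<^bsub>Grp D\<^esub>, 1)"] b(1)
    by (simp add: E E_add coords_group coords_x coords_one vlinear_scale[OF vlinear_coords]
        lookup_single)
  then have "vscale (inverse (\<xi> g)) (vscale (\<xi> g) ?z) = vscale (inverse (\<xi> g)) (vscale (\<xi> g) (\<iota> g))"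
    by (rule arg_cong)
  then have "?z = \<iota> g"
    using \<xi>_nonzero[OF g] by simp
  ultimately show ?thesis by simp
qed

lemmas cl_group_x_and_elt = rank_one_brace.dt_group_x_and_elt[OF swapped]

lemma dt_mult_x_group:
  "g \<in> carrier (Grp D) \<Longrightarrow> dt (u \<star> x) (\<iota> g) = vscale (l g) (dt u (\<iota> g) \<star> x)"
  by (simp add: mult_dt sw_simps dt_x_group cl_group_x_and_elt elt mult_simps
      vbilinear_simps[OF vbilinear_dt])

lemma dt_mult_x_x: "dt (u \<star> x) x = vscale (l a * \<xi> a) (dt u x \<star> x)"
  by (simp add: mult_dt sw_simps dt_x_group cl_x_group dt_x_x cl_x_x cl_one_x dt_one_x
      elt mult_simps vbilinear_simps[OF vbilinear_dt])

text \<open>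
  Induction on the degree of \<open>u\<close>, starting from group elements; the hypothesis \<open>x \<cdot> x = x : x = 0\<close>
  enters through \<open>dt_mult_x_x\<close>.
\<close>

lemma dt_x: "dt u x = 0"
proof (rule span_induct[of "\<lambda>u. dt u x = 0"])
  show "dt (gx g m) x = 0" if "g \<in> carrier (Grp D)" for g m
    using that
    by (induction m) (simp_all add: gx_group dt_group_x_and_elt dt_mult_x_x mult_simps
        flip: gx_mult_x)
qed (simp_all add: vbilinear_simps[OF vbilinear_dt])

lemma dt_mult_x: "dt u (v \<star> x) = 0"
  by (simp add: dt_mult dt_x vbilinear_simps[OF vbilinear_dt])

lemma restrict_op:
  assumes "g \<in> carrier (Grp D)" "h \<in> carrier (Grp D)" "\<And>u v. dt u v = p (u \<otimes>\<^sub>k v)"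
  shows "restrict_op (Grp D) \<iota> p g h \<in> carrier (Grp D)"
    and "\<iota> (restrict_op (Grp D) \<iota> p g h) = p (\<iota> g \<otimes>\<^sub>k \<iota> h)"
proof -
  obtain k where k: "k \<in> carrier (Grp D)" "dt (\<iota> g) (\<iota> h) = \<iota> k"
    using dt_group[OF assms(1,2)] by blast
  then have "restrict_op (Grp D) \<iota> p g h = k"
    using the_inv_into_f_f[OF \<iota>_inj] by (simp add: restrict_op_def flip: assms(3))
  with k show "restrict_op (Grp D) \<iota> p g h \<in> carrier (Grp D)"
    "\<iota> (restrict_op (Grp D) \<iota> p g h) = p (\<iota> g \<otimes>\<^sub>k \<iota> h)"
    by (simp_all flip: assms(3))
qed

end

section \<open>Isomorphisms\<close>

text \<open>
  The image of \<open>x\<close> is skew-primitive with respect to \<open>1\<close> and \<open>f a\<close>, and \<open>F\<close> transports the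
  relation \<open>x a = q a x\<close> with \<open>q \<noteq> 1\<close>. As \<open>f a\<close> is central, the classification
  of skew-primitives applies.
\<close>

lemma hopf_morphism_x:
  assumes "rank_one_hopf_algebra D H \<iota> x" "rank_one_hopf_algebra D' H' \<iota>' x'"
    and F: "hopf_morphism H H' F"
    and f: "f \<in> Group.iso (Grp D) (Grp D')"
    and F_group: "\<And>g. g \<in> carrier (Grp D) \<Longrightarrow> F (\<iota> g) = \<iota>' (f g)"
  obtains c where "F x = vscale c x'"
proof -
  interpret A: rank_one_hopf_algebra D H \<iota> x by fact
  interpret B: rank_one_hopf_algebra D' H' \<iota>' x' by fact
  have lin: "vlinear F" and comult_F: "\<And>v. comult H' (F v) = sw H v (\<lambda>v1 v2. F v1 \<otimes>\<^sub>k F v2)"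
    and mult: "\<And>u v. F (u \<star>\<^bsub>H\<^esub> v) = F u \<star>\<^bsub>H'\<^esub> F v" and one: "F \<eta>\<^bsub>H\<^esub> = \<eta>\<^bsub>H'\<^esub>"
    using F by (auto simp: hopf_morphism_def coalgebra_morphism_def)
  have fa: "f (Elt D) \<in> carrier (Grp D')"
    using f A.elt by (auto simp: Group.iso_def hom_def)
  show thesis
  proof (rule B.skew_primitive_multiple_of_x[OF _ fa])
    show "comult H' (F x) = F x \<otimes>\<^sub>k \<iota>' (f (Elt D)) + \<eta>\<^bsub>H'\<^esub> \<otimes>\<^sub>k F x"
      by (simp add: comult_F A.sw_x vbilinear_comp2[OF vbilinear_tens lin lin] one F_group A.elt)
    show "f (Elt D) \<otimes>\<^bsub>Grp D'\<^esub> g = g \<otimes>\<^bsub>Grp D'\<^esub> f (Elt D)" if "g \<in> carrier (Grp D')" for g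
    proof -
      have "g \<in> f ` carrier (Grp D)"
        using f that by (simp add: Group.iso_def bij_betw_def)
      then obtain h where "h \<in> carrier (Grp D)" "g = f h" by blast
      moreover have "f \<in> hom (Grp D) (Grp D')"
        using f by (simp add: Group.iso_def)
      ultimately show ?thesis
        using A.central A.elt by (metis hom_mult)
    qed
    show "F x \<star>\<^bsub>H'\<^esub> \<iota>' (f (Elt D)) =
        vscale (Chi D (Elt D)) (\<iota>' (f (Elt D)) \<star>\<^bsub>H'\<^esub> F x)"
      using A.x_comm[OF A.elt] A.elt by (simp add: vlinear_scale[OF lin] flip: F_group mult)
    show "Chi D (Elt D) \<noteq> 1"
      using A.q_pow_eq_1_iff[of 1] A.n_gt_1 by auto
  qed (use that in blast)
qed

text \<open>
  The right operand is reduced first: if it has positive degree in \<open>x\<close>, both sides are 0. If it is a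
  group element \<open>g\<close>, induction on the degree of the left operand applies, since
  \<open>ux \<cdot> g = \<lambda>(g) (u \<cdot> g) x\<close> holds in both algebras with matching characters.
\<close>

lemma hopf_morphism_preserves_op:
  assumes "rank_one_brace D H \<iota> x dt cl l \<xi>" "rank_one_brace D' H' \<iota>' x' dt' cl' l' \<xi>'"
    and F: "hopf_morphism H H' F"
    and f: "\<And>g. g \<in> carrier (Grp D) \<Longrightarrow> f g \<in> carrier (Grp D')"
    and F_group: "\<And>g. g \<in> carrier (Grp D) \<Longrightarrow> F (\<iota> g) = \<iota>' (f g)"
    and F_x: "F x = vscale c x'"
    and F_dt: "\<And>g h. g \<in> carrier (Grp D) \<Longrightarrow> h \<in> carrier (Grp D) \<Longrightarrow>
      F (dt (\<iota> g) (\<iota> h)) = dt' (\<iota>' (f g)) (\<iota>' (f h))"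
    and l: "\<And>g. g \<in> carrier (Grp D) \<Longrightarrow> l g = l' (f g)"
  shows "F (dt u v) = dt' (F u) (F v)"
proof -
  interpret A: rank_one_brace D H \<iota> x dt cl l \<xi> by fact
  interpret B: rank_one_brace D' H' \<iota>' x' dt' cl' l' \<xi>' by fact
  have lin: "vlinear F" and mult: "\<And>u v. F (u \<star>\<^bsub>H\<^esub> v) = F u \<star>\<^bsub>H'\<^esub> F v"
    using F by (auto simp: hopf_morphism_def coalgebra_morphism_def)
  note simps = vlinear_add[OF lin] vlinear_scale[OF lin] vlinear_0[OF lin]
    vbilinear_simps[OF A.vbilinear_dt] vbilinear_simps[OF B.vbilinear_dt] B.mult_simps
  have group: "F (dt u (\<iota> g)) = dt' (F u) (\<iota>' (f g))" if g: "g \<in> carrier (Grp D)" for u g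
  proof (rule A.span_induct[of "\<lambda>u. F (dt u (\<iota> g)) = dt' (F u) (\<iota>' (f g))"])
    show "F (dt (A.gx h m) (\<iota> g)) = dt' (F (A.gx h m)) (\<iota>' (f g))" if "h \<in> carrier (Grp D)" for h m
      using g that
      by (induction m)
        (simp_all add: A.gx_group F_dt F_group A.dt_mult_x_group B.dt_mult_x_group f mult F_x
          simps l mult.commute flip: A.gx_mult_x)
  qed (simp_all add: simps)
  show ?thesis
  proof (rule A.span_induct[of "\<lambda>v. F (dt u v) = dt' (F u) (F v)"])
    show "F (dt u (A.gx g m)) = dt' (F u) (F (A.gx g m))" if "g \<in> carrier (Grp D)" for g m
      using that
      by (cases m) (simp_all add: A.gx_group group F_group A.dt_mult_x B.dt_mult_x mult F_x simps
          flip: A.gx_mult_x)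
  qed (simp_all add: simps)
qed

lemma hopf_morphism_preserves_op_iff:
  assumes A: "rank_one_brace D H \<iota> x (\<lambda>u v. p (u \<otimes>\<^sub>k v)) cl l \<xi>"
    and B: "rank_one_brace D' H' \<iota>' x' (\<lambda>u v. p' (u \<otimes>\<^sub>k v)) cl' l' \<xi>'"
    and F: "hopf_morphism H H' F"
    and f: "\<And>g. g \<in> carrier (Grp D) \<Longrightarrow> f g \<in> carrier (Grp D')"
    and F_group: "\<And>g. g \<in> carrier (Grp D) \<Longrightarrow> F (\<iota> g) = \<iota>' (f g)"
    and F_x: "F x = vscale c x'" "c \<noteq> 0"
  shows "(\<forall>u v. F (p (u \<otimes>\<^sub>k v)) = p' (F u \<otimes>\<^sub>k F v)) \<longleftrightarrow>
    (\<forall>g\<in>carrier (Grp D). \<forall>h\<in>carrier (Grp D).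
      f (restrict_op (Grp D) \<iota> p g h) = restrict_op (Grp D') \<iota>' p' (f g) (f h)) \<and>
    (\<forall>g\<in>carrier (Grp D). l g = l' (f g))"
proof -
  interpret A: rank_one_brace D H \<iota> x "\<lambda>u v. p (u \<otimes>\<^sub>k v)" cl l \<xi> by fact
  interpret B: rank_one_brace D' H' \<iota>' x' "\<lambda>u v. p' (u \<otimes>\<^sub>k v)" cl' l' \<xi>' by fact
  have lin: "vlinear F"
    using F by (simp add: hopf_morphism_def coalgebra_morphism_def)
  have restrict: "f (restrict_op (Grp D) \<iota> p g h) = restrict_op (Grp D') \<iota>' p' (f g) (f h) \<longleftrightarrow>
      F (p (\<iota> g \<otimes>\<^sub>k \<iota> h)) = p' (\<iota>' (f g) \<otimes>\<^sub>k \<iota>' (f h))"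
    if "g \<in> carrier (Grp D)" "h \<in> carrier (Grp D)" for g h
  proof -
    note r = A.restrict_op[OF that refl] B.restrict_op[OF f[OF that(1)] f[OF that(2)] refl]
    show ?thesis
      unfolding r(2)[symmetric] r(4)[symmetric] F_group[OF r(1)]
      using inj_on_eq_iff[OF B.\<iota>_inj f[OF r(1)] r(3)] by simp
  qed
  have character: "F (p (x \<otimes>\<^sub>k \<iota> g)) = p' (F x \<otimes>\<^sub>k F (\<iota> g)) \<longleftrightarrow> l g = l' (f g)"
    if g: "g \<in> carrier (Grp D)" for g
  proof -
    have "F (p (x \<otimes>\<^sub>k \<iota> g)) = vscale (l g * c) x'"
      by (simp add: A.dt_x_group[OF g] vlinear_scale[OF lin] F_x)
    moreover have "p' (F x \<otimes>\<^sub>k F (\<iota> g)) = vscale (l' (f g) * c) x'"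
      by (simp add: F_group[OF g] F_x B.dt_x_group[OF f[OF g]]
          vbilinear_simps[OF B.vbilinear_dt] mult.commute)
    ultimately have "F (p (x \<otimes>\<^sub>k \<iota> g)) - p' (F x \<otimes>\<^sub>k F (\<iota> g)) = vscale ((l g - l' (f g)) * c) x'"
      using vscale_add_left[of "(l g - l' (f g)) * c" "l' (f g) * c" x'] by (simp add: algebra_simps)
    then have "F (p (x \<otimes>\<^sub>k \<iota> g)) - p' (F x \<otimes>\<^sub>k F (\<iota> g)) = 0 \<longleftrightarrow> l g - l' (f g) = 0"
      using B.x_nonzero F_x(2) by (simp only: vscale_eq_0_iff) simp
    then show ?thesis by simp
  qed
  show ?thesis
  proof
    assume "\<forall>u v. F (p (u \<otimes>\<^sub>k v)) = p' (F u \<otimes>\<^sub>k F v)"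
    then show "(\<forall>g\<in>carrier (Grp D). \<forall>h\<in>carrier (Grp D).
        f (restrict_op (Grp D) \<iota> p g h) = restrict_op (Grp D') \<iota>' p' (f g) (f h)) \<and>
      (\<forall>g\<in>carrier (Grp D). l g = l' (f g))"
      using restrict character F_group by simp
  next
    assume "(\<forall>g\<in>carrier (Grp D). \<forall>h\<in>carrier (Grp D).
        f (restrict_op (Grp D) \<iota> p g h) = restrict_op (Grp D') \<iota>' p' (f g) (f h)) \<and>
      (\<forall>g\<in>carrier (Grp D). l g = l' (f g))"
    then show "\<forall>u v. F (p (u \<otimes>\<^sub>k v)) = p' (F u \<otimes>\<^sub>k F v)"
      using hopf_morphism_preserves_op[OF A B F f F_group F_x(1)] restrict by simp
  qed
qed

theorem mainTheorem5:
  fixes D :: "('g, 'k::{alg_closed_field, field_char_0}) rank_one_data"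
    and D' :: "('g', 'k) rank_one_data"
    and H :: "('b, 'k) hopf" and H' :: "('c, 'k) hopf"
    and \<iota> :: "'g \<Rightarrow> ('b \<Rightarrow>\<^sub>0 'k)" and \<iota>' :: "'g' \<Rightarrow> ('c \<Rightarrow>\<^sub>0 'k)"
    and x :: "'b \<Rightarrow>\<^sub>0 'k" and x' :: "'c \<Rightarrow>\<^sub>0 'k"
    and p d :: "('b \<times> 'b \<Rightarrow>\<^sub>0 'k) \<Rightarrow> ('b \<Rightarrow>\<^sub>0 'k)"
    and p' d' :: "('c \<times> 'c \<Rightarrow>\<^sub>0 'k) \<Rightarrow> ('c \<Rightarrow>\<^sub>0 'k)"
    and l \<xi> :: "'g \<Rightarrow> 'k" and l' \<xi>' :: "'g' \<Rightarrow> 'k"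
    and F :: "('b \<Rightarrow>\<^sub>0 'k) \<Rightarrow> ('c \<Rightarrow>\<^sub>0 'k)" and f :: "'g \<Rightarrow> 'g'"
  assumes "rank_one_hopf_algebra D H \<iota> x"
    and "rank_one_hopf_algebra D' H' \<iota>' x'"
    and "hopf_q_brace H p d"
    and "hopf_q_brace H' p' d'"
    and "p (x \<otimes>\<^sub>k x) = 0" and "d (x \<otimes>\<^sub>k x) = 0"
    and "p' (x' \<otimes>\<^sub>k x') = 0" and "d' (x' \<otimes>\<^sub>k x') = 0"
    and "l \<in> characters (Grp D)"
    and "\<And>g. g \<in> carrier (Grp D) \<Longrightarrow> p (x \<otimes>\<^sub>k \<iota> g) = vscale (l g) x"
    and "\<xi> \<in> characters (Grp D)"
    and "\<And>g. g \<in> carrier (Grp D) \<Longrightarrow> d (x \<otimes>\<^sub>k \<iota> g) = vscale (\<xi> g) x"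
    and "l' \<in> characters (Grp D')"
    and "\<And>g. g \<in> carrier (Grp D') \<Longrightarrow> p' (x' \<otimes>\<^sub>k \<iota>' g) = vscale (l' g) x'"
    and "\<xi>' \<in> characters (Grp D')"
    and "\<And>g. g \<in> carrier (Grp D') \<Longrightarrow> d' (x' \<otimes>\<^sub>k \<iota>' g) = vscale (\<xi>' g) x'"
    and "hopf_iso H H' F"
    and "f \<in> Group.iso (Grp D) (Grp D')"
    and "\<And>g. g \<in> carrier (Grp D) \<Longrightarrow> F (\<iota> g) = \<iota>' (f g)"
  shows "hopf_q_brace_iso H p d H' p' d' F \<longleftrightarrow>
    q_brace_iso (Grp D) (restrict_op (Grp D) \<iota> p) (restrict_op (Grp D) \<iota> d)
                (Grp D') (restrict_op (Grp D') \<iota>' p') (restrict_op (Grp D') \<iota>' d') f \<and>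
    (\<forall>g\<in>carrier (Grp D). l g = l' (f g)) \<and>
    (\<forall>g\<in>carrier (Grp D). \<xi> g = \<xi>' (f g))"
proof -
  have A: "rank_one_brace D H \<iota> x (\<lambda>u v. p (u \<otimes>\<^sub>k v)) (\<lambda>u v. d (u \<otimes>\<^sub>k v)) l \<xi>"
    by (intro rank_one_brace.intro rank_one_brace_axioms.intro hopf_q_brace_ops) (fact assms)+
  have B: "rank_one_brace D' H' \<iota>' x' (\<lambda>u v. p' (u \<otimes>\<^sub>k v)) (\<lambda>u v. d' (u \<otimes>\<^sub>k v)) l' \<xi>'"
    by (intro rank_one_brace.intro rank_one_brace_axioms.intro hopf_q_brace_ops) (fact assms)+
  note f_iso = \<open>f \<in> Group.iso (Grp D) (Grp D')\<close>
  note F_group = \<open>\<And>g. g \<in> carrier (Grp D) \<Longrightarrow> F (\<iota> g) = \<iota>' (f g)\<close>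
  have F: "hopf_morphism H H' F" "bij F"
    using \<open>hopf_iso H H' F\<close> by (auto simp: hopf_iso_def)
  have f: "f g \<in> carrier (Grp D')" if "g \<in> carrier (Grp D)" for g
    using f_iso that by (auto simp: Group.iso_def hom_def)
  obtain c where c: "F x = vscale c x'"
    using hopf_morphism_x[OF assms(1,2) F(1) f_iso F_group] by blast
  have "F 0 = 0"
    using F(1) by (intro vlinear_0) (simp add: hopf_morphism_def coalgebra_morphism_def)
  then have "F x \<noteq> 0"
    using rank_one_hopf_algebra.x_nonzero[OF assms(1)] \<open>bij F\<close> by (metis bij_is_inj injD)
  then have "c \<noteq> 0"
    using c by auto
  note iff = hopf_morphism_preserves_op_iff[OF A B F(1) f F_group c \<open>c \<noteq> 0\<close>]
    hopf_morphism_preserves_op_iff[OF rank_one_brace.swapped[OF A] rank_one_brace.swapped[OF B]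
      F(1) f F_group c \<open>c \<noteq> 0\<close>]
  show ?thesis
    using F f_iso
    by (simp add: hopf_q_brace_iso_def hopf_q_brace_morphism_def q_brace_iso_def iff) blast
qed

end
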